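(* Let $N\ge1$, $k\in\mathbb{Z}$, $m\in\mathbb{Z}_{>0}$, $\Gamma\in\{\Gamma_0(N),\Gamma_1(N)\}$, and let $\psi\in J^N_{k,\frac mN}(\Gamma)$ be meromorphic with only simple poles, located at $z=z_s=\alpha\tau+\beta$, $s=(\alpha,\beta)\in S(\psi)\subset\mathbb{Q}^2$, $\{z_s\}$ discrete. Then $\psi(\tau,z)=\psi^F(\tau,z)+\psi^P(\tau,z)$.
   Context: Notation: $\mathbf{e}(t)=e^{2\pi it}$, $q=\mathbf{e}(\tau)$, $\zeta=\mathbf{e}(z)$. $\Gamma_0(N)$: $c\equiv0\bmod N$; $\Gamma_1(N)$: also $a\equiv d\equiv1\bmod N$. $J^N_{k,\frac mN}(\Gamma)$: functions $\psi$ on $\mathbb{H}\times\mathbb{C}$ with $\psi(\frac{a\tau+b}{c\tau+d},\frac z{c\tau+d})=(c\tau+d)^k\mathbf{e}(\frac mN\frac{cz^2}{c\tau+d})\psi(\tau,z)$ for $\gamma\in\Gamma$ and $\psi(\tau,z+\lambda\tau+\mu)=\mathbf{e}(-\frac mN(\lambda^2\tau+2\lambda z+\lambda\mu))\psi(\tau,z)$ for $(\lambda,\mu)\in N\mathbb{Z}\times\mathbb{Z}$. Definitions: $D_s(\tau)=2\pi i\,\mathbf{e}(\frac mN\alpha z_s)\operatorname{Res}_{z=z_s}\psi(\tau,z)$. $\vartheta_{m,\ell}(\tau,z)=\sum_{r\equiv\ell\bmod2m}q^{r^2/4m}\zeta^r$. $h_\ell(\tau)=q^{-\ell^2N/4m}\int_{-\frac{\ell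 N}{2m}\tau}^{-\frac{\ell N}{2m}\tau+1}\psi(\tau,z)\mathbf{e}(-\ell z)dz$ along the straight segment, where (the paper's convention) poles lying on the segment contribute half their residue, i.e. the integral is the average of those along paths deformed slightly above and below; $h_\ell$ depends only on $\ell\bmod2m$, and $\psi^F(\tau,z)=\sum_{\ell\bmod2m}h_\ell(\tau)\vartheta_{m,\ell}(N\tau,z)$. For $c\in\mathbb{R}$: $\mathcal{R}_c(\zeta)=\frac{\zeta^c}{2}\frac{\zeta+1}{\zeta-1}$ if $c\in\mathbb{Z}$ and $\frac{\zeta^{\lceil c\rceil}}{\zeta-1}$ otherwise. For $s=(\alpha,\beta)\in\mathbb{Q}^2$, $\zeta_s=\mathbf{e}(z_s)$: $\widetilde{\mathcal{A}}^s_{\frac mN}(\tau,z)=\mathbf{e}(-\frac mN\alpha z_s)\sum_{\lambda\in\mathbb{Z}}q^{mN\lambda^2}\zeta^{2m\lambda}\mathcal{R}_{-2m\alpha/N}(q^{N\lambda}\zeta/\zeta_s)$. $\psi^P(\tau,z)=\sum_{s\in S(\psi)/(N\mathbb{Z}\times\mathbb{Z})}D_s(\tau)\widetilde{\mathcal{A}}^s_{\frac mN}(\tau,z)$, the sum running over orbits of $S(\psi)$ under translation by $N\mathbb{Z}\times\mathbb{Z}$ (independent of representatives). *)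

theory Defs
  imports "HOL-Complex_Analysis.Complex_Analysis"
begin

definition ee :: "complex \<Rightarrow> complex" where
  "ee t = exp (2 * of_real pi * \<i> * t)"

definition Gamma0 :: "nat \<Rightarrow> (int \<times> int \<times> int \<times> int) set" where
  "Gamma0 N = {(a,b,c,d). a*d - b*c = 1 \<and> int N dvd c}"

definition Gamma1 :: "nat \<Rightarrow> (int \<times> int \<times> int \<times> int) set" where
  "Gamma1 N = {(a,b,c,d). a*d - b*c = 1 \<and> int N dvd c
                 \<and> a mod int N = 1 mod int N \<and> d mod int N = 1 mod int N}"

definition zs :: "real \<times> real \<Rightarrow> complex \<Rightarrow> complex" where
  "zs s \<tau> = of_real (fst s) * \<tau> + of_real (snd s)"

definition jacobi_poles :: "(complex \<Rightarrow> complex \<Rightarrow> complex) \<Rightarrow> (real \<times> real) set" where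
  "jacobi_poles \<psi> = {s. \<exists>\<tau>. Im \<tau> > 0 \<and> is_pole (\<psi> \<tau>) (zs s \<tau>)}"

definition pole_points :: "(complex \<Rightarrow> complex \<Rightarrow> complex) \<Rightarrow> complex \<Rightarrow> complex set" where
  "pole_points \<psi> \<tau> = (\<lambda>s. zs s \<tau>) ` jacobi_poles \<psi>"

text \<open>Meromorphic with only simple poles, located at the points z_s, s in S(psi), which form
  a discrete set (for each tau); psi is holomorphic (separately in tau and z, hence jointly
  by Hartogs) away from the poles.\<close>
definition mero_simple_poles :: "(complex \<Rightarrow> complex \<Rightarrow> complex) \<Rightarrow> bool" where
  "mero_simple_poles \<psi> \<longleftrightarrow>
     (\<forall>\<tau>. Im \<tau> > 0 \<longrightarrow>
        \<not> (\<exists>z. z islimpt pole_points \<psi> \<tau>)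
      \<and> \<psi> \<tau> holomorphic_on (- pole_points \<psi> \<tau>)
      \<and> (\<forall>p \<in> pole_points \<psi> \<tau>. \<exists>c. ((\<lambda>w. (w - p) * \<psi> \<tau> w) \<longlongrightarrow> c) (at p)))
   \<and> (\<forall>z. (\<lambda>\<tau>. \<psi> \<tau> z) holomorphic_on {\<tau>. Im \<tau> > 0 \<and> z \<notin> pole_points \<psi> \<tau>})"

definition jacobi_transformation ::
  "nat \<Rightarrow> int \<Rightarrow> nat \<Rightarrow> (int \<times> int \<times> int \<times> int) set \<Rightarrow> (complex \<Rightarrow> complex \<Rightarrow> complex) \<Rightarrow> bool" where
  "jacobi_transformation N k m \<Gamma> \<psi> \<longleftrightarrow>
     (\<forall>a b c d \<tau> z. (a,b,c,d) \<in> \<Gamma> \<longrightarrow> Im \<tau> > 0 \<longrightarrow> z \<notin> pole_points \<psi> \<tau> \<longrightarrow>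
        \<psi> ((of_int a * \<tau> + of_int b) / (of_int c * \<tau> + of_int d)) (z / (of_int c * \<tau> + of_int d))
        = (of_int c * \<tau> + of_int d) powi k
          * ee (of_nat m / of_nat N * (of_int c * z^2 / (of_int c * \<tau> + of_int d))) * \<psi> \<tau> z)
   \<and> (\<forall>l \<mu> \<tau> z. Im \<tau> > 0 \<longrightarrow> z \<notin> pole_points \<psi> \<tau> \<longrightarrow>
        (let lam = of_int (int N * l) :: complex in
          \<psi> \<tau> (z + lam * \<tau> + of_int \<mu>)
          = ee (- (of_nat m / of_nat N) * (lam^2 * \<tau> + 2 * lam * z + lam * of_int \<mu>)) * \<psi> \<tau> z))"

definition Dcoef :: "nat \<Rightarrow> nat \<Rightarrow> (complex \<Rightarrow> complex \<Rightarrow> complex) \<Rightarrow> real \<times> real \<Rightarrow> complex \<Rightarrow> complex" where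
  "Dcoef N m \<psi> s \<tau> = 2 * of_real pi * \<i> * ee (of_nat m / of_nat N * of_real (fst s) * zs s \<tau>)
                       * residue (\<psi> \<tau>) (zs s \<tau>)"

definition theta :: "nat \<Rightarrow> int \<Rightarrow> complex \<Rightarrow> complex \<Rightarrow> complex" where
  "theta m l \<tau> z = (\<Sum>\<^sub>\<infinity> r \<in> {r::int. r mod (2 * int m) = l mod (2 * int m)}.
                       ee (of_int r ^ 2 / (4 * of_nat m) * \<tau> + of_int r * z))"

definition seg_integral :: "(complex \<Rightarrow> complex \<Rightarrow> complex) \<Rightarrow> int \<Rightarrow> complex \<Rightarrow> complex \<Rightarrow> real \<Rightarrow> complex" where
  "seg_integral \<psi> l \<tau> w \<epsilon> =
     contour_integral (linepath (w + \<i> * of_real \<epsilon>) (w + \<i> * of_real \<epsilon> + 1)) (\<lambda>z. \<psi> \<tau> z * ee (- of_int l * z))"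

text \<open>h_l(tau), with the convention that poles on the segment contribute half their residue:
  the integral is the average of the integrals along the paths deformed slightly above and below.\<close>
definition hcoef :: "nat \<Rightarrow> nat \<Rightarrow> (complex \<Rightarrow> complex \<Rightarrow> complex) \<Rightarrow> int \<Rightarrow> complex \<Rightarrow> complex" where
  "hcoef N m \<psi> l \<tau> =
     (let w = - (of_int l * of_nat N / (2 * of_nat m)) * \<tau> in
      ee (- (of_int l ^ 2 * of_nat N / (4 * of_nat m)) * \<tau>)
      * ((Lim (at_right 0) (seg_integral \<psi> l \<tau> w) + Lim (at_left 0) (seg_integral \<psi> l \<tau> w)) / 2))"

definition psiF :: "nat \<Rightarrow> nat \<Rightarrow> (complex \<Rightarrow> complex \<Rightarrow> complex) \<Rightarrow> complex \<Rightarrow> complex \<Rightarrow> complex" where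
  "psiF N m \<psi> \<tau> z = (\<Sum>l \<in> {0..<2 * int m}. hcoef N m \<psi> l \<tau> * theta m l (of_nat N * \<tau>) z)"

definition Rc :: "real \<Rightarrow> complex \<Rightarrow> complex" where
  "Rc c w = (if c \<in> \<int> then w powi \<lfloor>c\<rfloor> / 2 * ((w + 1) / (w - 1))
             else w powi \<lceil>c\<rceil> / (w - 1))"

definition Atilde :: "nat \<Rightarrow> nat \<Rightarrow> real \<times> real \<Rightarrow> complex \<Rightarrow> complex \<Rightarrow> complex" where
  "Atilde N m s \<tau> z =
     ee (- (of_nat m / of_nat N) * of_real (fst s) * zs s \<tau>)
     * (\<Sum>\<^sub>\<infinity> lam::int.
          ee (of_nat m * of_nat N * of_int lam ^ 2 * \<tau>) * ee (2 * of_nat m * of_int lam * z)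
          * Rc (- 2 * real m * fst s / real N)
               (ee (of_nat N * of_int lam * \<tau>) * ee z / ee (zs s \<tau>)))"

definition lattice_rel :: "nat \<Rightarrow> (real \<times> real) set \<Rightarrow> ((real \<times> real) \<times> (real \<times> real)) set" where
  "lattice_rel N S = {(s,t). s \<in> S \<and> t \<in> S \<and>
      (\<exists>l \<mu> :: int. t = (fst s + real N * of_int l, snd s + of_int \<mu>))}"

definition psiP :: "nat \<Rightarrow> nat \<Rightarrow> (complex \<Rightarrow> complex \<Rightarrow> complex) \<Rightarrow> complex \<Rightarrow> complex \<Rightarrow> complex" where
  "psiP N m \<psi> \<tau> z =
     (\<Sum>Orb \<in> jacobi_poles \<psi> // lattice_rel N (jacobi_poles \<psi>).
        let s = (SOME s. s \<in> Orb) in Dcoef N m \<psi> s \<tau> * Atilde N m s \<tau> z)"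

end

theory Submission
  imports Defs
begin

text \<open>Fix \<open>\<tau>\<close> and put \<open>T = N\<tau>\<close>. An entire function \<open>\<phi>\<close> with the elliptic transformation law of
  \<open>\<psi>(\<tau>, \<cdot>)\<close> is recovered from its Fourier coefficients by integrating \<open>\<phi>(u) A(u)\<close> along the
  two lines \<open>Im (u - z) = \<plusminus> Im T / 2\<close>, where \<open>A(u)\<close> is an Appell-Lerch sum in \<open>z - u\<close>: the pole at
  \<open>u = z\<close> contributes \<open>\<phi>(z)\<close>, and shifting one line to the other by \<open>T\<close> leaves a finite
  combination of theta functions, because \<open>(w\<^sup>2\<^sup>m - 1) / (w - 1)\<close> is a polynomial. The polar part
  \<open>\<psi>\<^sup>P\<close> obeys the same law and has the same residues as \<open>\<psi>\<close>, so \<open>\<psi> - \<psi>\<^sup>P\<close> extends to such a \<open>\<phi>\<close>.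
  Finally, the integrals defining \<open>h\<^sub>l\<close> vanish on \<open>\<psi>\<^sup>P\<close>: just above and just below the prescribed
  line they are opposite to each other. Hence \<open>\<psi>\<close> and \<open>\<phi>\<close> have the same \<open>h\<^sub>l\<close>.\<close>

section \<open>Integrals over a period\<close>

text \<open>The cancellation on the polar part is built into the exponent of \<open>Rc\<close>. In
  the variable v = n T + u - x, where x is a pole, the n-th term leaves an integral of w^(r+p) / (w
  - 1) with w = \<open>ee v\<close> and r = 2mn - l. Expanded in powers of w above the real axis and
  of 1/w below it, the integrand lacks a constant term exactly for r + p \<ge> 1, respectively r + p
  \<le> 0. The line prescribed for h_l lies at height a positive multiple of r + c, where c =
  -2m\<alpha>/N, so p must turn the sign of r + c into this dichotomy;
  \<open>\<lceil>c\<rceil>\<close> and \<open>\<lfloor>c\<rfloor> + 1\<close> both do. They differ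
  only for integral c, and only then can some term have r + c = 0, that is, a pole on the line.
  There the mean of the two exponents makes the values just above and just below opposite, which is
  what the half-residue convention asks for. All contours are horizontal unit segments: primitives
  on convex sets give independence of the height, and the explicit kernel integrals -1, 0 and 1
  stand in for residues.\<close>

lemma ee_add: "ee (a + b) = ee a * ee b"
  by (simp add: ee_def distrib_left exp_add)

lemma ee_0 [simp]: "ee 0 = 1"
  by (simp add: ee_def)

lemma ee_nonzero [simp]: "ee z \<noteq> 0"
  by (simp add: ee_def)

lemma ee_minus: "ee (- z) = inverse (ee z)"
  by (simp add: ee_def exp_minus)

lemma ee_diff: "ee (a - b) = ee a / ee b"
  using ee_add[of a "- b"] by (simp add: ee_minus divide_inverse)

lemma ee_of_nat_mult: "ee (of_nat n * z) = ee z ^ n"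
  by (induction n) (simp_all add: distrib_right ee_add)

lemma ee_of_int_mult: "ee (of_int n * z) = ee z powi n"
proof (cases "n \<ge> 0")
  case True
  then show ?thesis
    using ee_of_nat_mult[of "nat n" z] by (simp add: power_int_def)
next
  case False
  then have "ee (of_int n * z) = ee (- (of_nat (nat (- n)) * z))" by simp
  then show ?thesis
    using False by (simp only: ee_minus ee_of_nat_mult) (simp add: power_int_def power_inverse)
qed

lemma ee_eq_1_iff: "ee z = 1 \<longleftrightarrow> (\<exists>n::int. z = of_int n)"
proof -
  have "ee z = 1 \<longleftrightarrow> (\<exists>n::int. Re z = n \<and> Im z = 0)"
    unfolding ee_def exp_eq_1 by (auto simp: field_simps)
  then show ?thesis by (simp add: complex_eq_iff)
qed

lemma ee_of_int [simp]: "ee (of_int n) = 1"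
  using ee_eq_1_iff by blast

lemma ee_1 [simp]: "ee 1 = 1"
  using ee_of_int[of 1] by simp

lemma ee_plus_of_int [simp]: "ee (z + of_int n) = ee z"
  by (simp add: ee_add)

lemma ee_plus_1 [simp]: "ee (z + 1) = ee z"
  by (simp add: ee_add)

lemma norm_ee: "norm (ee z) = exp (- 2 * pi * Im z)"
  by (simp add: ee_def)

lemma holomorphic_on_ee [holomorphic_intros]:
  "f holomorphic_on A \<Longrightarrow> (\<lambda>x. ee (f x)) holomorphic_on A"
  unfolding ee_def by (intro holomorphic_intros)

lemma continuous_on_ee [continuous_intros]:
  "continuous_on A f \<Longrightarrow> continuous_on A (\<lambda>x. ee (f x))"
  unfolding ee_def by (intro continuous_intros)

lemma ee_neq_1: "Im v \<noteq> 0 \<Longrightarrow> ee v \<noteq> 1"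
  by (auto simp: ee_eq_1_iff)

lemma tendsto_ee [tendsto_intros]:
  "(f \<longlongrightarrow> a) F \<Longrightarrow> ((\<lambda>x. ee (f x)) \<longlongrightarrow> ee a) F"
  unfolding ee_def by (intro tendsto_intros)

lemma DERIV_ee: "(ee has_field_derivative 2 * of_real pi * \<i> * ee z) (at z within A)"
  unfolding ee_def[abs_def] by (auto intro!: derivative_eq_intros)

text \<open>With imaginary part at least 1 in modulus, |\<open>ee z\<close>| is at most 1/e or at
  least e, hence far from 1. This controls all but finitely many denominators of an Appell-Lerch sum
  at once.\<close>

lemma ee_minus_one_lower:
  assumes "\<bar>Im z\<bar> \<ge> 1"
  shows "norm (ee z - 1) \<ge> 1 / 2"
proof (cases "Im z \<ge> 0")
  case True
  then have "norm (ee z) \<le> exp (-1)"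
    using assms pi_gt3 mult_mono[of 1 "2*pi" 1 "Im z"] by (simp add: norm_ee)
  also have "exp (-1) \<le> (1/2::real)"
    using exp_ge_add_one_self[of 1] by (simp add: exp_minus field_simps)
  finally show ?thesis
    using norm_triangle_ineq2[of 1 "ee z"] by (simp add: norm_minus_commute)
next
  case False
  then have "norm (ee z) \<ge> exp 1"
    using assms pi_gt3 mult_mono[of 1 "2*pi" 1 "- Im z"] by (simp add: norm_ee)
  moreover have "exp 1 \<ge> (2::real)"
    using exp_ge_add_one_self[of 1] by simp
  ultimately show ?thesis
    using norm_triangle_ineq2[of "ee z" 1] by simp
qed

section \<open>Integrals of 1-periodic functions along horizontal unit segments\<close>

definition period_integral :: "complex \<Rightarrow> (complex \<Rightarrow> complex) \<Rightarrow> complex" where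
  "period_integral a g = contour_integral (linepath a (a + 1)) g"

lemma period_integral_eq: "period_integral a g = integral {0..1} (\<lambda>t. g (a + of_real t))"
  unfolding period_integral_def contour_integral_integral
  by (simp add: linepath_def scaleR_conv_of_real algebra_simps)

text \<open>Equality is asked on the whole horizontal line and not just on the segment, because
  every pole-avoidance condition below depends on \<open>Im u\<close> alone.\<close>

lemma period_integral_cong:
  assumes "\<And>u. Im u = Im a \<Longrightarrow> f u = g u"
  shows "period_integral a f = period_integral a g"
  unfolding period_integral_eq by (intro integral_cong) (simp add: assms)

lemma period_integral_shift:
  "period_integral (a + c) g = period_integral a (\<lambda>u. g (u + c))"
  unfolding period_integral_eq by (simp add: add_ac)

lemma Im_segment: "u \<in> closed_segment a (a + 1) \<Longrightarrow> Im u = Im a"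
  by (auto simp: closed_segment_def algebra_simps)

lemma linepath_integrable_on_line:
  assumes "continuous_on {u. Im u = Im a} g"
  shows "g contour_integrable_on (linepath a (a + 1))"
  by (intro contour_integrable_continuous_linepath continuous_on_subset[OF assms])
     (auto dest: Im_segment)

lemma period_integral_add:
  assumes "continuous_on {u. Im u = Im a} f" "continuous_on {u. Im u = Im a} g"
  shows "period_integral a (\<lambda>u. f u + g u) = period_integral a f + period_integral a g"
  unfolding period_integral_def
  by (intro contour_integral_add linepath_integrable_on_line assms)

lemma period_integral_diff:
  assumes "continuous_on {u. Im u = Im a} f" "continuous_on {u. Im u = Im a} g"
  shows "period_integral a (\<lambda>u. f u - g u) = period_integral a f - period_integral a g"
  unfolding period_integral_def
  by (intro contour_integral_diff linepath_integrable_on_line assms)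

lemma period_integral_cmult:
  "period_integral a (\<lambda>u. c * f u) = c * period_integral a f"
  unfolding period_integral_eq by simp

lemma period_integral_sum:
  assumes "finite A" "\<And>i. i \<in> A \<Longrightarrow> continuous_on {u. Im u = Im a} (f i)"
  shows "period_integral a (\<lambda>u. \<Sum>i\<in>A. f i u) = (\<Sum>i\<in>A. period_integral a (f i))"
  unfolding period_integral_def
  by (intro contour_integral_sum linepath_integrable_on_line assms)

lemma period_integral_const [simp]: "period_integral a (\<lambda>u. c) = c"
  unfolding period_integral_eq by simp

text \<open>Cauchy's theorem for the parallelogram a, a + 1, b + 1, b: convexity supplies a
  primitive \<open>G\<close>, and the two slanted sides contribute equally by periodicity.\<close>

lemma period_integral_independent:
  assumes "convex S" "open S" and holo: "g holomorphic_on S"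
    and per: "\<And>u. u \<in> S \<Longrightarrow> u + 1 \<in> S \<and> g (u + 1) = g u"
    and ab: "a \<in> S" "b \<in> S"
  shows "period_integral a g = period_integral b g"
proof -
  obtain G where G: "\<And>x. x \<in> S \<Longrightarrow> (G has_field_derivative g x) (at x within S)"
    using holomorphic_convex_primitive'[OF assms(1,2) holo] by blast
  have int: "contour_integral (linepath x y) g = G y - G x" if "x \<in> S" "y \<in> S" for x y
    using contour_integral_primitive[OF G, where g = "linepath x y"] that \<open>convex S\<close>
    by (auto intro!: contour_integral_unique simp: closed_segment_subset)
  have "contour_integral (linepath (a+1) (b+1)) g
      = integral {0..1} (\<lambda>t. g (linepath a b t + 1) * (b - a))"
    unfolding contour_integral_integral
    by (intro integral_cong) (simp add: linepath_def scaleR_conv_of_real algebra_simps)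
  also have "\<dots> = integral {0..1} (\<lambda>t. g (linepath a b t) * (b - a))"
  proof (intro integral_cong)
    fix t :: real assume "t \<in> {0..1}"
    then have "linepath a b t \<in> S"
      using ab \<open>convex S\<close> by (metis closed_segment_subset imageI linepath_image_01 subsetD)
    then show "g (linepath a b t + 1) * (b - a) = g (linepath a b t) * (b - a)"
      using per by simp
  qed
  also have "\<dots> = contour_integral (linepath a b) g"
    by (simp add: contour_integral_integral)
  finally have "contour_integral (linepath (a+1) (b+1)) g = contour_integral (linepath a b) g" .
  then have "G (b + 1) - G (a + 1) = G b - G a"
    using int per ab by simp
  then have "G (a + 1) - G a = G (b + 1) - G b"
    by (simp add: algebra_simps)
  moreover have "contour_integral (linepath a (a+1)) g = G (a+1) - G a"
    "contour_integral (linepath b (b+1)) g = G (b+1) - G b"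
    using int per ab by auto
  ultimately show ?thesis
    unfolding period_integral_def by simp
qed

lemma convex_Im_strip: "convex {u::complex. l < Im u \<and> Im u < h}"
proof -
  have "{u::complex. l < Im u \<and> Im u < h} = {u. Im u > l} \<inter> {u. Im u < h}" by auto
  then show ?thesis
    by (simp add: convex_Int convex_halfspace_Im_gt convex_halfspace_Im_lt)
qed

lemma open_Im_strip: "open {u::complex. l < Im u \<and> Im u < h}"
  by (intro open_Collect_conj open_Collect_less continuous_intros)

text \<open>On either half plane the integrand is the derivative of a function of \<open>ee v\<close>,
  respectively \<open>ee (- v)\<close>, which is holomorphic on the unit disc.\<close>
lemma period_integral_disc:
  assumes k: "k holomorphic_on ball 0 1" and \<sigma>: "\<sigma> = 1 \<or> \<sigma> = (-1::real)" "\<sigma> * Im a > 0"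
  shows "period_integral a (\<lambda>v. ee (of_real \<sigma> * v) * k (ee (of_real \<sigma> * v))) = 0"
proof -
  obtain G where G: "\<And>x. x \<in> ball 0 1 \<Longrightarrow> (G has_field_derivative k x) (at x)"
    using holomorphic_convex_primitive'[OF _ _ k] by (metis at_within_open convex_ball open_ball)
  let ?c = "2 * of_real pi * \<i> * of_real \<sigma>"
  have c: "?c \<noteq> 0" using \<sigma> by auto
  have D: "((\<lambda>v. G (ee (of_real \<sigma> * v)) / ?c) has_field_derivative
          ee (of_real \<sigma> * v) * k (ee (of_real \<sigma> * v))) (at v within {v. \<sigma> * Im v > 0})"
    if "v \<in> {v. \<sigma> * Im v > 0}" for v
  proof -
    have "ee (of_real \<sigma> * v) \<in> ball 0 1"
      using that by (simp add: norm_ee mult_less_0_iff)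
    then have "((\<lambda>v. G (ee (of_real \<sigma> * v)) / ?c) has_field_derivative
       k (ee (of_real \<sigma> * v)) * ((2 * of_real pi * \<i> * ee (of_real \<sigma> * v)) * of_real \<sigma>) / ?c)
       (at v within {v. \<sigma> * Im v > 0})"
      by (intro DERIV_cdivide DERIV_chain2[of G] DERIV_chain2[of ee] G DERIV_ee)
         (auto intro!: derivative_eq_intros)
    then show ?thesis using c by (simp add: field_simps)
  qed
  have "closed_segment a (a + 1) \<subseteq> {v. \<sigma> * Im v > 0}"
    using \<sigma>(2) by (auto dest!: Im_segment)
  then
  have "((\<lambda>v. ee (of_real \<sigma> * v) * k (ee (of_real \<sigma> * v))) has_contour_integral
      G (ee (of_real \<sigma> * (a + 1))) / ?c - G (ee (of_real \<sigma> * a)) / ?c) (linepath a (a + 1))"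
    using contour_integral_primitive[OF D, of "linepath a (a + 1)"] by simp
  moreover have "ee (of_real \<sigma> * (a + 1)) = ee (of_real \<sigma> * a)"
    using \<sigma> ee_plus_of_int[of "-a" "-1"] by auto
  ultimately show ?thesis
    unfolding period_integral_def by (simp add: contour_integral_unique)
qed

section \<open>The kernels w^n / (w - 1), w = \<open>ee v\<close>, above and below the real
  axis\<close>

text \<open>Above the axis |w| < 1 and the integrand is a power series in w;
  \<open>n \<ge> 1\<close> says that it has no constant term. The factor split off in
  \<open>k\<close> is the one that the disc lemma demands.\<close>

lemma period_integral_upper:
  assumes "Im a > 0" "n \<ge> 1"
  shows "period_integral a (\<lambda>v. ee (of_int n * v) / (ee v - 1)) = 0"
proof -
  define k where "k = (\<lambda>x::complex. x ^ nat (n - 1) / (x - 1))"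
  have "k holomorphic_on ball 0 1"
    unfolding k_def by (intro holomorphic_intros) auto
  from period_integral_disc[OF this, of 1 a] assms
  have "period_integral a (\<lambda>v. ee v * k (ee v)) = 0" by simp
  moreover have "ee v * k (ee v) = ee (of_int n * v) / (ee v - 1)" for v
  proof -
    have "ee (of_int n * v) = ee v * ee v ^ nat (n - 1)"
      using assms by (simp add: ee_of_int_mult power_int_def flip: power_Suc) (metis Suc_nat_eq_nat_zadd1 diff_add_cancel diff_ge_0_iff_ge add.commute)
    then show ?thesis by (simp add: k_def)
  qed
  ultimately show ?thesis by simp
qed

text \<open>Below the axis the expansion is in y = \<open>ee (- v)\<close>: the integrand equals y *
  y^(-n) / (1 - y), without constant term as soon as \<open>n \<le> 0\<close>. The threshold is thus
  0 here against 1 above.\<close>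

lemma period_integral_lower:
  assumes "Im a < 0" "n \<le> 0"
  shows "period_integral a (\<lambda>v. ee (of_int n * v) / (ee v - 1)) = 0"
proof -
  define k where "k = (\<lambda>x::complex. x ^ nat (- n) / (1 - x))"
  have "k holomorphic_on ball 0 1"
    unfolding k_def by (intro holomorphic_intros) auto
  from period_integral_disc[OF this, of "-1" a] assms
  have "period_integral a (\<lambda>v. ee (- v) * k (ee (- v))) = 0" by simp
  moreover have "ee (- v) * k (ee (- v)) = ee (of_int n * v) / (ee v - 1)"
    if "Im v = Im a" for v
  proof -
    have "norm (ee v) > 1" using that assms by (simp add: norm_ee mult_less_0_iff)
    then have ne: "ee v \<noteq> 1" by auto
    have "ee (of_int n * v) = ee (- v) ^ nat (- n)"
      using assms by (simp add: ee_of_int_mult power_int_def ee_minus)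
    then show ?thesis using ne by (simp add: k_def ee_minus divide_simps)
  qed
  ultimately show ?thesis
    using period_integral_cong[of a "\<lambda>v. ee (- v) * k (ee (- v))"] by simp
qed

lemma continuous_on_line_kernel:
  assumes "c \<noteq> 0"
  shows "continuous_on {v. Im v = c} (\<lambda>v. ee (of_int n * v) / (ee v - 1))"
  using assms by (intro continuous_intros) (auto simp: ee_eq_1_iff)

text \<open>The borderline exponent above the axis: 1/(w - 1) = w/(w - 1) - 1, and only the constant
  survives.\<close>

lemma period_integral_upper_0:
  assumes "Im a > 0"
  shows "period_integral a (\<lambda>v. 1 / (ee v - 1)) = -1"
proof -
  have "period_integral a (\<lambda>v. 1 / (ee v - 1))
      = period_integral a (\<lambda>v. ee (of_int 1 * v) / (ee v - 1) - 1)"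
    using assms by (intro period_integral_cong) (auto simp: divide_simps ee_eq_1_iff)
  also have "\<dots> = -1"
    using assms continuous_on_line_kernel[of "Im a" 1] period_integral_upper[of a 1]
    by (subst period_integral_diff) auto
  finally show ?thesis .
qed

text \<open>The borderline exponent below the axis: w/(w - 1) = 1/(w - 1) + 1, again leaving only
  the constant.\<close>

lemma period_integral_lower_1:
  assumes "Im a < 0"
  shows "period_integral a (\<lambda>v. ee v / (ee v - 1)) = 1"
proof -
  have "period_integral a (\<lambda>v. ee v / (ee v - 1))
      = period_integral a (\<lambda>v. ee (of_int 0 * v) / (ee v - 1) + 1)"
    using assms by (intro period_integral_cong) (auto simp: divide_simps ee_eq_1_iff)
  also have "\<dots> = 1"
    using assms continuous_on_line_kernel[of "Im a" 0] period_integral_lower[of a 0]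
    by (subst period_integral_add) auto
  finally show ?thesis .
qed

lemma period_integral_infsum:
  assumes ul: "uniform_limit (closed_segment a (a + 1)) (\<lambda>X u. \<Sum>x\<in>X. f x u) (\<lambda>u. \<Sum>\<^sub>\<infinity>x\<in>A. f x u)
                 (finite_subsets_at_top A)"
    and cont: "\<And>x. x \<in> A \<Longrightarrow> continuous_on {u. Im u = Im a} (f x)"
  shows "period_integral a (\<lambda>u. \<Sum>\<^sub>\<infinity>x\<in>A. f x u) = (\<Sum>\<^sub>\<infinity>x\<in>A. period_integral a (f x))"
proof -
  have "((\<lambda>X. period_integral a (\<lambda>u. \<Sum>x\<in>X. f x u)) \<longlongrightarrow>
          period_integral a (\<lambda>u. \<Sum>\<^sub>\<infinity>x\<in>A. f x u)) (finite_subsets_at_top A)"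
    unfolding period_integral_def
  proof (rule contour_integral_uniform_limit(2))
    show "\<forall>\<^sub>F X in finite_subsets_at_top A.
            (\<lambda>u. \<Sum>x\<in>X. f x u) contour_integrable_on linepath a (a + 1)"
      by (intro eventually_finite_subsets_at_top_weakI linepath_integrable_on_line
            continuous_on_sum cont) auto
    show "uniform_limit (path_image (linepath a (a + 1))) (\<lambda>X u. \<Sum>x\<in>X. f x u)
            (\<lambda>u. \<Sum>\<^sub>\<infinity>x\<in>A. f x u) (finite_subsets_at_top A)"
      using ul by simp
  qed auto
  then have "((\<lambda>X. \<Sum>x\<in>X. period_integral a (f x)) \<longlongrightarrow>
          period_integral a (\<lambda>u. \<Sum>\<^sub>\<infinity>x\<in>A. f x u)) (finite_subsets_at_top A)"
    by (rule Lim_transform_eventually)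
       (intro eventually_finite_subsets_at_top_weakI period_integral_sum cont; auto)
  then show ?thesis
    by (intro infsumI[symmetric]) (simp add: has_sum_def)
qed

section \<open>Appell-Lerch sums\<close>

lemma summable_on_int_exp_neg_abs: "(\<lambda>n::int. exp (- \<bar>real_of_int n\<bar>)) summable_on UNIV"
proof -
  have "summable (\<lambda>n. norm (exp (- real n)))"
    using summable_geometric[of "exp (-1::real)"] by (simp add: exp_of_nat_mult[symmetric])
  then have nat: "(\<lambda>n. exp (- real n)) summable_on UNIV"
    by (rule norm_summable_imp_summable_on)
  have "(\<lambda>n::int. exp (- \<bar>real_of_int n\<bar>)) summable_on {0..}"
  proof -
    have "bij_betw int UNIV {0..}"
      by (rule bij_betwI[where g = nat]) auto
    from summable_on_reindex_bij_betw[OF this, of "\<lambda>n. exp (- \<bar>real_of_int n\<bar>)"]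
    show ?thesis using nat by simp
  qed
  moreover have "(\<lambda>n::int. exp (- \<bar>real_of_int n\<bar>)) summable_on {..<0}"
  proof -
    have "bij_betw (\<lambda>n. - int (Suc n)) UNIV {..<0}"
      by (rule bij_betwI[where g = "\<lambda>n. nat (- n - 1)"]) auto
    from summable_on_reindex_bij_betw[OF this, of "\<lambda>n. exp (- \<bar>real_of_int n\<bar>)"]
    have "(\<lambda>n::int. exp (- \<bar>real_of_int n\<bar>)) summable_on {..<0}
        \<longleftrightarrow> (\<lambda>n. exp (-1) * exp (- real n)) summable_on UNIV"
      by (simp add: exp_add[symmetric] algebra_simps)
    then show ?thesis using summable_on_cmult_right[OF nat] by simp
  qed
  ultimately have "(\<lambda>n::int. exp (- \<bar>real_of_int n\<bar>)) summable_on ({0..} \<union> {..<0})"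
    by (rule summable_on_Un_disjoint) auto
  moreover have "{0..} \<union> {..<0} = (UNIV :: int set)" by auto
  ultimately show ?thesis by simp
qed

lemma summable_on_int_gauss:
  assumes "A > 0"
  shows "(\<lambda>n::int. exp (- A * real_of_int n ^ 2 + B * \<bar>real_of_int n\<bar>)) summable_on L"
proof -
  \<comment> \<open>The maximum of -A x^2 + (B + 1) x, found by completing the square; B + 1 instead
    of B leaves a spare factor exp(-|x|) to sum.\<close>
  define C where "C = (B + 1)\<^sup>2 / (4 * A)"
  have bound: "exp (- A * x ^ 2 + B * \<bar>x\<bar>) \<le> exp C * exp (- \<bar>x\<bar>)" for x :: real
  proof -
    have "A * (\<bar>x\<bar> - (B + 1) / (2 * A))\<^sup>2 \<ge> 0" using assms by simp
    also have "A * (\<bar>x\<bar> - (B + 1) / (2 * A))\<^sup>2 = A * x ^ 2 - (B + 1) * \<bar>x\<bar> + C"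
      using assms by (simp add: C_def power2_diff power_divide field_simps power2_eq_square)
    finally have "- A * x ^ 2 + B * \<bar>x\<bar> \<le> C - \<bar>x\<bar>" by (simp add: algebra_simps)
    then show ?thesis by (simp flip: exp_add)
  qed
  have "(\<lambda>n::int. exp C * exp (- \<bar>real_of_int n\<bar>)) summable_on UNIV"
    by (intro summable_on_cmult_right summable_on_int_exp_neg_abs)
  then have "(\<lambda>n::int. exp (- A * real_of_int n ^ 2 + B * \<bar>real_of_int n\<bar>)) summable_on UNIV"
    using bound by (rule summable_on_comparison_test) auto
  then show ?thesis using summable_on_subset_banach by blast
qed

lemma norm_ee_gauss:
  assumes "\<bar>Im a\<bar> \<le> B"
  shows "norm (ee (of_nat m * of_int n ^ 2 * T + of_int n * a))
      \<le> exp (- (2 * pi * real m * Im T) * real_of_int n ^ 2 + 2 * pi * B * \<bar>real_of_int n\<bar>)"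
proof -
  have "- (real_of_int n * Im (a)) \<le> \<bar>real_of_int n\<bar> * B"
    using assms abs_ge_minus_self[of "real_of_int n * Im (a)"] mult_left_mono[of "\<bar>Im (a)\<bar>" B "\<bar>real_of_int n\<bar>"]
    unfolding abs_mult by linarith
  then have "pi * - (real_of_int n * Im (a)) \<le> pi * (\<bar>real_of_int n\<bar> * B)"
    by (intro mult_left_mono) auto
  moreover have "Im (of_nat m * of_int n ^ 2 * T + of_int n * a)
      = real m * real_of_int n ^ 2 * Im T + real_of_int n * Im (a)"
  proof -
    have "(of_nat m * of_int n ^ 2 :: complex) = of_real (real m * real_of_int n ^ 2)" by simp
    then show ?thesis by (simp only: plus_complex.sel) simp
  qed
  ultimately show "norm (ee (of_nat m * of_int n ^ 2 * T + of_int n * a))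
      \<le> exp (- (2 * pi * real m * Im T) * real_of_int n ^ 2 + 2 * pi * B * \<bar>real_of_int n\<bar>)"
    by (simp add: norm_ee algebra_simps)
qed

lemma theta_term_summable:
  assumes "m \<ge> 1" "Im T > 0"
  shows "(\<lambda>n::int. ee (of_nat m * of_int n ^ 2 * T + of_int n * a + b)) summable_on L"
proof -
  have "(\<lambda>n::int. exp (- (2 * pi * real m * Im T) * real_of_int n ^ 2
          + 2 * pi * \<bar>Im a\<bar> * \<bar>real_of_int n\<bar>)) summable_on L"
    using assms by (intro summable_on_int_gauss) auto
  then have "(\<lambda>n::int. norm (ee (of_nat m * of_int n ^ 2 * T + of_int n * a))) summable_on L"
    by (rule summable_on_comparison_test) (use norm_ee_gauss in \<open>simp_all del: mult_minus_left\<close>)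
  then have "(\<lambda>n::int. ee (of_nat m * of_int n ^ 2 * T + of_int n * a)) summable_on L"
    by (rule abs_summable_summable)
  then show ?thesis
    unfolding ee_add[of _ b] by (rule summable_on_cmult_left)
qed

text \<open>The summation is over a set of integers \<open>L\<close>, so that the term responsible for a given pole
  can be split off.\<close>
definition lerch_term :: "nat \<Rightarrow> complex \<Rightarrow> complex \<Rightarrow> complex \<Rightarrow> int \<Rightarrow> complex" where
  "lerch_term m T a v n = ee (of_nat m * of_int n ^ 2 * T + of_int n * a) / (ee (of_int n * T + v) - 1)"

text \<open>For \<open>L = UNIV\<close> this is, up to sign and normalisation, the Appell function
  of level 2m. The arguments \<open>a\<close> and \<open>v\<close> are kept independent since the
  applications let either of them move with the variable.\<close>

definition lerch_sum :: "nat \<Rightarrow> complex \<Rightarrow> int set \<Rightarrow> complex \<Rightarrow> complex \<Rightarrow> complex" where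
  "lerch_sum m T L a v = (\<Sum>\<^sub>\<infinity>n\<in>L. lerch_term m T a v n)"

text \<open>On a compact set \<open>v\<close> is bounded, so for large |n| the point n T + v is far
  from the real axis and 1/2 is a lower bound; each of the finitely many other n has a positive
  minimum by compactness.\<close>

lemma lerch_denominator_lower:
  fixes v :: "complex \<Rightarrow> complex"
  assumes T: "Im T > 0" and K: "compact K" "continuous_on K v"
    and ne: "\<And>t n. t \<in> K \<Longrightarrow> n \<in> L \<Longrightarrow> ee (of_int n * T + v t) \<noteq> 1"
  obtains \<delta> where "\<delta> > 0" "\<And>t n. t \<in> K \<Longrightarrow> n \<in> L \<Longrightarrow> norm (ee (of_int n * T + v t) - 1) \<ge> \<delta>"
proof -
  have "bounded (v ` K)" using K compact_continuous_image compact_imp_bounded by blast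
  then obtain B where B: "\<And>t. t \<in> K \<Longrightarrow> norm (v t) \<le> B"
    by (auto simp: bounded_iff)
  \<comment> \<open>Beyond \<open>M\<close> one has |n| Im T \<ge> |B| + 1, so a height of at least
    1 remains after \<open>v\<close> has moved the point by at most B.\<close>
  define M where "M = \<lceil>(\<bar>B\<bar> + 1) / Im T\<rceil>"
  have far: "norm (ee (of_int n * T + v t) - 1) \<ge> 1 / 2" if "t \<in> K" "\<bar>n\<bar> > M" for t n
  proof (rule ee_minus_one_lower)
    have "(\<bar>B\<bar> + 1) / Im T \<le> \<bar>real_of_int n\<bar>" using that unfolding M_def by linarith
    then have "\<bar>B\<bar> + 1 \<le> \<bar>real_of_int n\<bar> * Im T" using T by (simp add: field_simps)
    moreover have "\<bar>Im (v t)\<bar> \<le> B" using B[OF that(1)] abs_Im_le_cmod order_trans by blast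
    moreover have "\<bar>real_of_int n * Im T\<bar> = \<bar>real_of_int n\<bar> * Im T" using T by (simp add: abs_mult)
    ultimately show "\<bar>Im (of_int n * T + v t)\<bar> \<ge> 1" by simp
  qed
  have "\<exists>d>0. \<forall>t\<in>K. norm (ee (of_int n * T + v t) - 1) \<ge> d" if "n \<in> L" for n
  proof (cases "K = {}")
    case False
    have "continuous_on K (\<lambda>t. norm (ee (of_int n * T + v t) - 1))"
      by (intro continuous_intros K)
    from continuous_attains_inf[OF K(1) False this] show ?thesis
      using ne[OF _ that] by (metis right_minus_eq zero_less_norm_iff)
  qed (auto intro: zero_less_one)
  then obtain d where d: "\<And>n. n \<in> L \<Longrightarrow> d n > 0"
    "\<And>n t. n \<in> L \<Longrightarrow> t \<in> K \<Longrightarrow> norm (ee (of_int n * T + v t) - 1) \<ge> d n"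
    by metis
  let ?D = "insert (1/2) (d ` (L \<inter> {-M..M}))"
  have fin: "finite ?D" by auto
  show thesis
  proof (rule that[of "Min ?D"])
    show "Min ?D > 0" using fin d by (subst Min_gr_iff) auto
    fix t n assume tn: "t \<in> K" "n \<in> L"
    show "norm (ee (of_int n * T + v t) - 1) \<ge> Min ?D"
    proof (cases "\<bar>n\<bar> > M")
      case True
      then show ?thesis using far[OF tn(1)] fin Min_le[OF fin, of "1/2"] by force
    next
      case False
      then have "n \<in> L \<inter> {-M..M}" using tn by auto
      then have "d n \<in> ?D" by blast
      then have "Min ?D \<le> d n" by (rule Min_le[OF fin])
      then show ?thesis using d(2)[OF tn(2,1)] by linarith
    qed
  qed
qed

lemma lerch_sum_majorant:
  fixes a v :: "complex \<Rightarrow> complex"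
  assumes m: "m \<ge> 1" and T: "Im T > 0" and K: "compact K" "continuous_on K a" "continuous_on K v"
    and ne: "\<And>t n. t \<in> K \<Longrightarrow> n \<in> L \<Longrightarrow> ee (of_int n * T + v t) \<noteq> 1"
  obtains M where "M summable_on L"
    "\<And>n t. n \<in> L \<Longrightarrow> t \<in> K \<Longrightarrow> norm (lerch_term m T (a t) (v t) n) \<le> M n"
proof -
  obtain \<delta> where \<delta>: "\<delta> > 0" "\<And>t n. t \<in> K \<Longrightarrow> n \<in> L \<Longrightarrow> norm (ee (of_int n * T + v t) - 1) \<ge> \<delta>"
    using lerch_denominator_lower[OF T K(1,3) ne] by metis
  have "bounded (a ` K)" using K compact_continuous_image compact_imp_bounded by blast
  then obtain B where B: "\<And>t. t \<in> K \<Longrightarrow> norm (a t) \<le> B"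
    by (auto simp: bounded_iff)
  define M where "M = (\<lambda>n::int. exp (- (2 * pi * real m * Im T) * real_of_int n ^ 2
                         + 2 * pi * B * \<bar>real_of_int n\<bar>) * (1 / \<delta>))"
  show thesis
  proof (rule that[of M])
    show "M summable_on L"
      unfolding M_def using m T by (intro summable_on_cmult_left summable_on_int_gauss) auto
    fix n t assume tn: "n \<in> L" "t \<in> K"
    have "\<bar>Im (a t)\<bar> \<le> B" using B[OF tn(2)] abs_Im_le_cmod order_trans by blast
    then have "norm (ee (of_nat m * of_int n ^ 2 * T + of_int n * a t))
        \<le> exp (- (2 * pi * real m * Im T) * real_of_int n ^ 2 + 2 * pi * B * \<bar>real_of_int n\<bar>)"
      by (rule norm_ee_gauss)
    moreover have "1 / norm (ee (of_int n * T + v t) - 1) \<le> 1 / \<delta>"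
      using \<delta>(1) \<delta>(2)[OF tn(2,1)] by (intro divide_left_mono mult_pos_pos) (auto intro: less_le_trans)
    ultimately show "norm (lerch_term m T (a t) (v t) n) \<le> M n"
      unfolding lerch_term_def M_def norm_divide
      by (subst divide_inverse, intro mult_mono) (simp_all add: inverse_eq_divide)
  qed
qed

lemma lerch_sum_uniform_limit:
  fixes a v :: "complex \<Rightarrow> complex"
  assumes "m \<ge> 1" "Im T > 0" "compact K" "continuous_on K a" "continuous_on K v"
    and "\<And>t n. t \<in> K \<Longrightarrow> n \<in> L \<Longrightarrow> ee (of_int n * T + v t) \<noteq> 1"
  shows "uniform_limit K (\<lambda>X t. \<Sum>n\<in>X. lerch_term m T (a t) (v t) n)
           (\<lambda>t. lerch_sum m T L (a t) (v t)) (finite_subsets_at_top L)"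
proof -
  obtain M where "M summable_on L"
    "\<And>n t. n \<in> L \<Longrightarrow> t \<in> K \<Longrightarrow> norm (lerch_term m T (a t) (v t) n) \<le> M n"
    using lerch_sum_majorant[OF assms] by blast
  then show ?thesis
    unfolding lerch_sum_def by (intro Weierstrass_m_test_general[where M = M])
qed

lemma lerch_term_summable:
  assumes "m \<ge> 1" "Im T > 0" "\<And>n. n \<in> L \<Longrightarrow> ee (of_int n * T + v) \<noteq> 1"
  shows "lerch_term m T a v summable_on L"
proof -
  obtain M where "M summable_on L" "\<And>n. n \<in> L \<Longrightarrow> norm (lerch_term m T a v n) \<le> M n"
    using lerch_sum_majorant[of m T "{0}" "\<lambda>_. a" "\<lambda>_. v" L] assms by (metis compact_sing continuous_on_const singletonI)
  then have "(\<lambda>n. norm (lerch_term m T a v n)) summable_on L"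
    by (auto intro: summable_on_comparison_test)
  then show ?thesis by (rule abs_summable_summable)
qed

text \<open>Weierstrass: on every closed disc inside \<open>S\<close> the finite partial sums, which
  are holomorphic, converge uniformly.\<close>

lemma lerch_sum_holomorphic:
  assumes mT: "m \<ge> 1" "Im T > 0" and S: "open S" "a holomorphic_on S" "v holomorphic_on S"
    and ne: "\<And>t n. t \<in> S \<Longrightarrow> n \<in> L \<Longrightarrow> ee (of_int n * T + v t) \<noteq> 1"
  shows "(\<lambda>t. lerch_sum m T L (a t) (v t)) holomorphic_on S"
proof -
  have "(\<lambda>t. lerch_sum m T L (a t) (v t)) field_differentiable at t0" if t0: "t0 \<in> S" for t0
  proof -
    obtain r where r: "r > 0" "cball t0 r \<subseteq> S"
      using S(1) t0 open_contains_cball by blast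
    have term_holo: "(\<lambda>t. \<Sum>n\<in>X. lerch_term m T (a t) (v t) n) holomorphic_on S"
      if "X \<subseteq> L" for X
      unfolding lerch_term_def using that ne S
      by (intro holomorphic_intros) auto
    have "(\<lambda>t. lerch_sum m T L (a t) (v t)) holomorphic_on ball t0 r"
    proof (rule holomorphic_uniform_limit)
      show "\<forall>\<^sub>F X in finite_subsets_at_top L.
          continuous_on (cball t0 r) (\<lambda>t. \<Sum>n\<in>X. lerch_term m T (a t) (v t) n) \<and>
          (\<lambda>t. \<Sum>n\<in>X. lerch_term m T (a t) (v t) n) holomorphic_on ball t0 r"
        using term_holo r
        by (intro eventually_finite_subsets_at_top_weakI)
           (meson ball_subset_cball holomorphic_on_imp_continuous_on holomorphic_on_subset order_trans)
      show "uniform_limit (cball t0 r) (\<lambda>X t. \<Sum>n\<in>X. lerch_term m T (a t) (v t) n)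
              (\<lambda>t. lerch_sum m T L (a t) (v t)) (finite_subsets_at_top L)"
        using r ne S by (intro lerch_sum_uniform_limit mT)
          (auto intro: holomorphic_on_imp_continuous_on holomorphic_on_subset)
    qed auto
    then show ?thesis
      using r(1) by (auto intro: holomorphic_on_imp_differentiable_at)
  qed
  then show ?thesis
    using S(1) by (simp add: holomorphic_on_def field_differentiable_at_within)
qed

lemma lerch_sum_split:
  assumes "m \<ge> 1" "Im T > 0" "\<And>n. ee (of_int n * T + v) \<noteq> 1"
  shows "lerch_sum m T UNIV a v = lerch_term m T a v k + lerch_sum m T (- {k}) a v"
proof -
  have "lerch_sum m T (insert k (- {k})) a v = lerch_term m T a v k + lerch_sum m T (- {k}) a v"
    unfolding lerch_sum_def using assms
    by (intro infsum_insert lerch_term_summable) auto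
  moreover have "insert k (- {k}) = UNIV" by auto
  ultimately show ?thesis by simp
qed

section \<open>Entire quasi-periodic functions\<close>

text \<open>\<open>Lim\<close> is a definite description, and the two limit predicates coincide; so
  the equation also holds where no limit exists. Functional equations can therefore be carried over
  to extensions defined by \<open>Lim\<close>.\<close>

lemma Lim_at_shift:
  fixes f :: "complex \<Rightarrow> complex"
  shows "Lim (at (a + d)) f = Lim (at a) (\<lambda>x. f (x + d))"
proof -
  have "(f \<longlongrightarrow> L) (at (a + d)) \<longleftrightarrow> ((\<lambda>x. f (x + d)) \<longlongrightarrow> L) (at a)" for L
    using filterlim_shift_iff[of f d "nhds L" "a + d"] by (simp add: o_def add.commute)
  then show ?thesis unfolding Topological_Spaces.Lim_def by simp
qed

text \<open>Riemann's theorem gives a holomorphic extension on a ball that meets \<open>P\<close> at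
  most in its centre. Each such extension is forced to equal \<open>Lim (at z) f\<close>, so this
  single formula glues them together without any choice.\<close>

lemma removable_extension:
  fixes f :: "complex \<Rightarrow> complex"
  assumes "open X" and discrete: "\<And>z. z \<in> X \<Longrightarrow> \<not> z islimpt P"
    and holo: "f holomorphic_on (X - P)"
    and lim: "\<And>p. p \<in> P \<inter> X \<Longrightarrow> ((\<lambda>z. (z - p) * f z) \<longlongrightarrow> 0) (at p)"
  shows "(\<lambda>z. Lim (at z) f) holomorphic_on X"
    and "\<And>z. z \<in> X \<Longrightarrow> (f \<longlongrightarrow> Lim (at z) f) (at z)"
    and "\<And>z. z \<in> X - P \<Longrightarrow> Lim (at z) f = f z"
proof -
  have local: "\<exists>r>0. \<exists>g. ball z r \<subseteq> X \<and> g holomorphic_on ball z r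
      \<and> (\<forall>w\<in>ball z r. (f \<longlongrightarrow> g w) (at w)) \<and> (\<forall>w\<in>ball z r - P. f w = g w)"
    if z: "z \<in> X" for z
  proof -
    obtain r1 where r1: "r1 > 0" "ball z r1 \<subseteq> X" using \<open>open X\<close> z open_contains_ball by blast
    obtain r2 where r2: "r2 > 0" "\<And>y. y \<in> P \<Longrightarrow> y \<noteq> z \<Longrightarrow> dist y z \<ge> r2"
      using discrete[OF z] unfolding islimpt_approachable by (meson not_less)
    define r where "r = min r1 r2"
    have r: "r > 0" "ball z r \<subseteq> X" "\<And>y. y \<in> ball z r \<Longrightarrow> y \<in> P \<Longrightarrow> y = z"
      using r1 r2 by (auto simp: r_def dist_commute subset_iff) force
    have h: "f holomorphic_on ball z r - {z}"
      using r by (intro holomorphic_on_subset[OF holo]) auto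
    have "((\<lambda>w. (w - z) * f w) \<longlongrightarrow> 0) (at z)"
    proof (cases "z \<in> P")
      case True
      then show ?thesis using lim z by simp
    next
      case False
      then have "ball z r \<subseteq> X - P" using r(2,3) by blast
      then have "f holomorphic_on ball z r"
        by (rule holomorphic_on_subset[OF holo])
      then have "f \<midarrow>z\<rightarrow> f z"
        using r(1) by (metis centre_in_ball continuous_on_interior holomorphic_on_imp_continuous_on
            interior_ball isCont_def)
      then have "((\<lambda>w. (w - z) * f w) \<longlongrightarrow> (z - z) * f z) (at z)"
        by (intro tendsto_intros)
      then show ?thesis by simp
    qed
    then obtain g where g: "g holomorphic_on ball z r" "\<forall>w\<in>ball z r - {z}. g w = f w"
      using holomorphic_on_extend_lim[OF h] r(1) by auto
    have cont: "(g \<longlongrightarrow> g w) (at w)" if "w \<in> ball z r" for w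
      using g(1) that by (metis continuous_on_interior holomorphic_on_imp_continuous_on
            interior_ball isCont_def)
    have lim: "(f \<longlongrightarrow> g w) (at w)" if w: "w \<in> ball z r" for w
    proof (rule Lim_transform_eventually[OF cont[OF w]])
      have "eventually (\<lambda>x. x \<in> ball z r - {z} - {w}) (at w)"
      proof (cases "w = z")
        case True
        then show ?thesis using eventually_at_in_open[of "ball z r" w] w by simp
      next
        case False
        then show ?thesis using eventually_at_in_open[of "ball z r - {z}" w] w False by (simp add: open_Diff dist_commute)
      qed
      then show "eventually (\<lambda>x. g x = f x) (at w)"
        by eventually_elim (use g(2) in auto)
    qed
    moreover have "f w = g w" if w: "w \<in> ball z r - P" for w
    proof (cases "w = z")
      case True
      have "ball z r \<subseteq> X - P" using r(2,3) w True by blast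
      then have "f holomorphic_on ball z r"
        by (rule holomorphic_on_subset[OF holo])
      then have "f \<midarrow>z\<rightarrow> f z"
        using r(1) by (metis centre_in_ball continuous_on_interior holomorphic_on_imp_continuous_on
            interior_ball isCont_def)
      then show ?thesis using lim[of z] r(1) True LIM_unique by (metis centre_in_ball)
    qed (use g w in auto)
    ultimately show ?thesis using r(1,2) g(1) by blast
  qed
  show *: "\<And>z. z \<in> X \<Longrightarrow> (f \<longlongrightarrow> Lim (at z) f) (at z)"
    using local by (metis centre_in_ball tendsto_Lim trivial_limit_at)
  show "\<And>z. z \<in> X - P \<Longrightarrow> Lim (at z) f = f z"
    using local by (metis DiffD1 DiffD2 DiffI centre_in_ball tendsto_Lim trivial_limit_at)
  have "(\<lambda>z. Lim (at z) f) field_differentiable at z" if z: "z \<in> X" for z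
  proof -
    obtain r g where r: "r > 0" "g holomorphic_on ball z r" "\<forall>w\<in>ball z r. (f \<longlongrightarrow> g w) (at w)"
      using local[OF z] by blast
    have "(\<lambda>z. Lim (at z) f) holomorphic_on ball z r"
      using r(3) by (intro holomorphic_transform[OF r(2)]) (auto intro!: tendsto_Lim[symmetric])
    then show ?thesis using r(1) by (auto intro: holomorphic_on_imp_differentiable_at)
  qed
  then show "(\<lambda>z. Lim (at z) f) holomorphic_on X"
    using \<open>open X\<close> by (simp add: holomorphic_on_def field_differentiable_at_within)
qed

text \<open>The quotient is the reciprocal of the difference quotient of \<open>ee (v u)\<close> at
  \<open>p\<close>, whose limit is nonzero.\<close>

lemma ee_simple_pole:
  assumes v: "(v has_field_derivative d) (at p)" "d \<noteq> 0" and p: "ee (v p) = 1"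
  shows "((\<lambda>u. (u - p) / (ee (v u) - 1)) \<longlongrightarrow> 1 / (2 * of_real pi * \<i> * d)) (at p)"
proof -
  have "((\<lambda>u. ee (v u)) has_field_derivative 2 * of_real pi * \<i> * ee (v p) * d) (at p)"
    by (rule DERIV_chain2[OF DERIV_ee v(1)])
  then have "((\<lambda>u. (ee (v u) - 1) / (u - p)) \<longlongrightarrow> 2 * of_real pi * \<i> * d) (at p)"
    unfolding has_field_derivative_iff using p by simp
  then have "((\<lambda>u. inverse ((ee (v u) - 1) / (u - p))) \<longlongrightarrow> inverse (2 * of_real pi * \<i> * d)) (at p)"
    using v(2) by (intro tendsto_inverse) auto
  then show ?thesis by (simp add: inverse_eq_divide)
qed

text \<open>Comparison of imaginary parts. It is used to show that the n-th denominator has no zero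
  at points where |Im v| is not |n| Im T.\<close>

lemma ee_lattice_eq_1_imp:
  assumes "Im T > 0" "ee (of_int n * T + v) = 1"
  shows "\<bar>Im v\<bar> = \<bar>of_int n\<bar> * Im T"
proof -
  obtain k :: int where "of_int n * T + v = of_int k" using assms(2) unfolding ee_eq_1_iff by auto
  then have "Im (of_int n * T + v) = Im (of_int k)" by (rule arg_cong)
  then have "Im v = - (of_int n * Im T)" by simp
  then show ?thesis using assms(1) by (simp add: abs_mult)
qed

lemma has_sum_finite_sum:
  fixes f :: "'i \<Rightarrow> 'a \<Rightarrow> complex"
  assumes "finite I" "\<And>i. i \<in> I \<Longrightarrow> f i summable_on A"
  shows "((\<lambda>x. \<Sum>i\<in>I. f i x) has_sum (\<Sum>i\<in>I. infsum (f i) A)) A"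
  using assms by (induction I rule: finite_induct) (auto intro!: has_sum_add has_sum_infsum)

section \<open>Theta functions and the expansion of an entire quasi-periodic function\<close>

text \<open>The theta function of class j with r = j + 2mn substituted and the factor
  \<open>ee (j^2 / (4 * m) * T)\<close> removed, since r^2/4m = m n^2 + n j + j^2/4m. The geometric
  sum below produces exactly this form, and the missing factor later cancels against the prefactor
  of \<open>hcoef\<close>.\<close>

definition theta_coeff :: "nat \<Rightarrow> complex \<Rightarrow> nat \<Rightarrow> complex \<Rightarrow> complex" where
  "theta_coeff m T j z =
     (\<Sum>\<^sub>\<infinity>n::int. ee (of_nat m * of_int n ^ 2 * T + of_int n * (2 * of_nat m * z) + of_nat j * (of_int n * T + z)))"

lemma theta_coeff_summable:
  assumes "m \<ge> 1" "Im T > 0"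
  shows "(\<lambda>n::int. ee (of_nat m * of_int n ^ 2 * T + of_int n * (2 * of_nat m * z)
            + of_nat j * (of_int n * T + z))) summable_on UNIV"
  using theta_term_summable[OF assms, of "2 * of_nat m * z + of_nat j * T" "of_nat j * z" UNIV]
  by (simp add: algebra_simps)

text \<open>The defect of quasi-periodicity of the kernel is a finite geometric sum in each term.\<close>
lemma lerch_sum_quasi_period:
  assumes mT: "m \<ge> 1" "Im T > 0" and ne: "\<And>n. ee (of_int n * T + (z - u)) \<noteq> 1"
  shows "ee (- (of_nat m * T + 2 * of_nat m * u)) * lerch_sum m T UNIV (2 * of_nat m * z) (z - (u + T))
       = lerch_sum m T UNIV (2 * of_nat m * z) (z - u)
         + (\<Sum>j<2*m. ee (- of_nat j * u) * theta_coeff m T j z)"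
proof -
  define a where "a = 2 * of_nat m * z"
  define E where "E = (\<lambda>n::int. ee (of_nat m * of_int n ^ 2 * T + of_int n * a))"
  define w where "w = (\<lambda>n::int. ee (of_int n * T + (z - u)))"
  define t where "t = (\<lambda>j n. ee (of_nat m * of_int n ^ 2 * T + of_int n * a + of_nat j * (of_int n * T + z)))"
  have t_sum: "(\<lambda>n. ee (- of_nat j * u) * t j n) summable_on UNIV" for j
    unfolding t_def a_def by (intro summable_on_cmult_right theta_coeff_summable mT)
  have t_has_sum: "((\<lambda>n. \<Sum>j<2*m. ee (- of_nat j * u) * t j n) has_sum
      (\<Sum>j<2*m. \<Sum>\<^sub>\<infinity>n. ee (- of_nat j * u) * t j n)) UNIV"
    by (intro has_sum_finite_sum t_sum) auto
  have bij: "bij_betw (\<lambda>n::int. n + 1) UNIV UNIV"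
    by (rule bij_betwI[where g = "\<lambda>n. n - 1"]) auto
  have "ee (- (of_nat m * T + 2 * of_nat m * u)) * lerch_sum m T UNIV a (z - (u + T))
      = ee (- (of_nat m * T + 2 * of_nat m * u)) * (\<Sum>\<^sub>\<infinity>n. lerch_term m T a (z - (u + T)) (n + 1))"
    unfolding lerch_sum_def
    using infsum_reindex_bij_betw[OF bij, of "lerch_term m T a (z - (u + T))"] by simp
  also have "\<dots> = (\<Sum>\<^sub>\<infinity>n. ee (- (of_nat m * T + 2 * of_nat m * u)) * lerch_term m T a (z - (u + T)) (n + 1))"
    by (simp add: infsum_cmult_right')
  also have "\<dots> = (\<Sum>\<^sub>\<infinity>n. lerch_term m T a (z - u) n + (\<Sum>j<2*m. ee (- of_nat j * u) * t j n))"
  proof (rule infsum_cong)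
    fix n :: int
    have wn: "w n \<noteq> 1" using ne by (simp add: w_def)
    have w': "ee (of_int (n + 1) * T + (z - (u + T))) = w n"
      by (simp add: w_def algebra_simps)
    \<comment> \<open>Replacing n by n + 1 undoes the shift u + T in the denominator; in the
      numerator it leaves the old term times w^(2m).\<close>
    have "- (of_nat m * T + 2 * of_nat m * u) + (of_nat m * of_int (n + 1) ^ 2 * T + of_int (n + 1) * a)
        = of_nat m * of_int n ^ 2 * T + of_int n * a + of_nat (2 * m) * (of_int n * T + (z - u))"
      by (simp add: a_def algebra_simps power2_eq_square)
    then have "ee (- (of_nat m * T + 2 * of_nat m * u)) * lerch_term m T a (z - (u + T)) (n + 1)
        = E n * w n ^ (2 * m) / (w n - 1)"
      unfolding lerch_term_def w' E_def w_def
      by (metis (no_types, lifting) ee_add ee_of_nat_mult times_divide_eq_right)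
    also have "w n ^ (2 * m) = 1 + (w n - 1) * (\<Sum>j<2*m. w n ^ j)"
      by (simp flip: power_diff_1_eq)
    also have "E n * (1 + (w n - 1) * (\<Sum>j<2*m. w n ^ j)) / (w n - 1)
        = E n / (w n - 1) + (\<Sum>j<2*m. E n * w n ^ j)"
      using wn by (simp add: field_simps sum_distrib_left)
    also have "(\<Sum>j<2*m. E n * w n ^ j) = (\<Sum>j<2*m. ee (- of_nat j * u) * t j n)"
      by (intro sum.cong refl) (simp add: E_def w_def t_def flip: ee_add ee_of_nat_mult,
            rule arg_cong[of _ _ ee], simp add: algebra_simps)
    finally show "ee (- (of_nat m * T + 2 * of_nat m * u)) * lerch_term m T a (z - (u + T)) (n + 1)
        = lerch_term m T a (z - u) n + (\<Sum>j<2*m. ee (- of_nat j * u) * t j n)"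
      by (simp add: lerch_term_def E_def w_def)
  qed
  also have "\<dots> = lerch_sum m T UNIV a (z - u) + (\<Sum>\<^sub>\<infinity>n. \<Sum>j<2*m. ee (- of_nat j * u) * t j n)"
    unfolding lerch_sum_def using t_has_sum
    by (intro infsum_add lerch_term_summable mT ne) (simp add: has_sum_imp_summable)
  also have "(\<Sum>\<^sub>\<infinity>n. \<Sum>j<2*m. ee (- of_nat j * u) * t j n)
      = (\<Sum>j<2*m. \<Sum>\<^sub>\<infinity>n. ee (- of_nat j * u) * t j n)"
    by (rule infsumI[OF t_has_sum])
  finally show ?thesis
    by (simp add: infsum_cmult_right' theta_coeff_def t_def a_def)
qed

text \<open>The base points \<open>b j\<close> are free because the integrands are entire and
  1-periodic. The freedom matters: each h_j is defined on a line of its own height.\<close>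

lemma quasi_periodic_expansion:
  assumes mT: "m \<ge> 1" "Im T > 0"
    and holo: "\<phi> holomorphic_on UNIV"
    and per: "\<And>u. \<phi> (u + 1) = \<phi> u"
    and quasi: "\<And>u. \<phi> (u + T) = ee (- (of_nat m * T + 2 * of_nat m * u)) * \<phi> u"
  shows "\<phi> z = (\<Sum>j<2*m. theta_coeff m T j z * period_integral (b j) (\<lambda>u. \<phi> u * ee (- of_nat j * u)))"
proof -
  define A where "A = (\<lambda>u. lerch_sum m T UNIV (2 * of_nat m * z) (z - u))"
  define A0 where "A0 = (\<lambda>u. lerch_sum m T (- {0}) (2 * of_nat m * z) (z - u))"
  define k where "k = (\<lambda>u. 1 / (ee (z - u) - 1))"
  \<comment> \<open>By periodicity \<open>\<phi>\<close> takes the value \<open>\<phi> z\<close> at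
    all poles z + n of \<open>k\<close>, so subtracting this constant makes them removable.\<close>
  define q where "q = (\<lambda>u. (\<phi> u - \<phi> z) * k u)"
  \<comment> \<open>In this strip only the summand n = 0 of \<open>A\<close> has poles; it still
    contains both lines of integration with room to spare.\<close>
  define S where "S = {u. Im z - Im T < Im u \<and> Im u < Im z + Im T}"
  define P where "P = range (\<lambda>n::int. z + of_int n)"
  define g where "g = (\<lambda>u. Lim (at u) q)"
  \<comment> \<open>Half a period below z: the lines through w and w + T lie on opposite sides of z,
    and |Im (z - u)| = Im T / 2 on them is not an integer multiple of Im T.\<close>
  define w where "w = z - T / 2"
  have S: "open S" "convex S" unfolding S_def by (rule open_Im_strip convex_Im_strip)+
  have S1: "u + 1 \<in> S" if "u \<in> S" for u using that by (simp add: S_def)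
  have w: "w \<in> S" "w + T \<in> S" "Im (w - z) < 0" "Im (w + T - z) > 0"
    using mT by (auto simp: S_def w_def)
  have cont: "continuous_on X \<phi>" for X
    using holo by (meson continuous_on_subset holomorphic_on_imp_continuous_on subset_UNIV)
  have per_int: "\<phi> (u + of_int n) = \<phi> u" for u and n :: int
  proof (induction n rule: int_induct[where k = 0])
    case (step1 i)
    then show ?case using per[of "u + of_int i"] by (simp add: add_ac)
  next
    case (step2 i)
    then show ?case using per[of "u + of_int (i - 1)"] by (simp add: add_ac)
  qed auto
  have k1: "k (u + 1) = k u" for u
    using ee_plus_of_int[of "z - u" "-1"] by (simp add: k_def algebra_simps)
  have P_iff: "u \<in> P \<longleftrightarrow> ee (z - u) = 1" for u
  proof
    assume "u \<in> P"
    then obtain n :: int where "z - u = of_int (- n)" by (auto simp: P_def)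
    then show "ee (z - u) = 1" unfolding ee_eq_1_iff by blast
  next
    assume "ee (z - u) = 1"
    then obtain n :: int where "z - u = of_int n" unfolding ee_eq_1_iff by blast
    then have "u = z + of_int (- n)" by (simp add: algebra_simps)
    then show "u \<in> P" unfolding P_def by blast
  qed
  have P_discrete: "\<not> u islimpt P" for u
  proof -
    have "dist x y \<ge> 1" if "x \<in> P" "y \<in> P" "x \<noteq> y" for x y
      using that by (auto simp: P_def dist_norm simp flip: of_int_diff)
    then show ?thesis
      by (intro discrete_imp_not_islimpt[of 1]) (auto simp: not_le[symmetric])
  qed
  have q_holo: "q holomorphic_on (S - P)"
    unfolding q_def k_def using P_iff holo by (intro holomorphic_intros) (auto intro: holomorphic_on_subset)
  have q_lim: "((\<lambda>u. (u - p) * q u) \<longlongrightarrow> 0) (at p)" if p: "p \<in> P \<inter> S" for p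
  proof -
    have "((\<lambda>u. z - u) has_field_derivative - 1) (at p)"
      by (auto intro!: derivative_eq_intros)
    from ee_simple_pole[OF this] have
      "((\<lambda>u. (u - p) / (ee (z - u) - 1)) \<longlongrightarrow> 1 / (2 * of_real pi * \<i> * (-1))) (at p)"
      using p P_iff by auto
    moreover have "(\<phi> \<longlongrightarrow> \<phi> p) (at p)"
      using cont[of UNIV] by (simp add: continuous_on_def)
    then have "((\<lambda>u. \<phi> u - \<phi> z) \<longlongrightarrow> 0) (at p)"
      using p per_int by (auto simp: P_def intro!: tendsto_eq_intros)
    ultimately have "((\<lambda>u. (\<phi> u - \<phi> z) * ((u - p) / (ee (z - u) - 1))) \<longlongrightarrow> 0) (at p)"
      using tendsto_mult by fastforce
    then show ?thesis by (simp add: q_def k_def mult_ac)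
  qed
  have g: "g holomorphic_on S" "\<And>u. u \<in> S - P \<Longrightarrow> g u = q u"
    unfolding g_def
    using removable_extension[OF S(1) P_discrete q_holo q_lim] by blast+
  have g1: "g (u + 1) = g u" for u
    unfolding g_def Lim_at_shift by (simp add: q_def k1 per)
  have A0_holo: "A0 holomorphic_on S"
    unfolding A0_def
  proof (intro lerch_sum_holomorphic mT S holomorphic_intros)
    fix u and n :: int
    assume u: "u \<in> S" "n \<in> - {0}"
    then have "\<bar>real_of_int n\<bar> \<ge> 1" by auto
    then have "\<bar>real_of_int n\<bar> * Im T \<ge> Im T" using mT by simp
    moreover have "\<bar>Im (z - u)\<bar> < Im T" using u by (auto simp: S_def)
    ultimately show "ee (of_int n * T + (z - u)) \<noteq> 1"
      using ee_lattice_eq_1_imp[OF mT(2), of n "z - u"] by linarith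
  qed
  have A01: "A0 (u + 1) = A0 u" for u
  proof -
    have "ee (of_int n * T + (z - (u + 1))) = ee (of_int n * T + (z - u))" for n
      using ee_plus_of_int[of "of_int n * T + (z - u)" "-1"] by (simp add: algebra_simps)
    then show ?thesis by (simp add: A0_def lerch_sum_def lerch_term_def)
  qed
  have generic: "ee (of_int n * T + (z - u)) \<noteq> 1" if "Im u = Im w \<or> Im u = Im (w + T)" for u n
  proof
    assume e: "ee (of_int n * T + (z - u)) = 1"
    have "\<bar>Im (z - u)\<bar> = Im T / 2" using that mT by (auto simp: w_def)
    then have "Im T / 2 = \<bar>of_int n\<bar> * Im T"
      using ee_lattice_eq_1_imp[OF mT(2) e] by linarith
    moreover have "\<bar>n\<bar> = 0 \<or> \<bar>n\<bar> \<ge> 1" by linarith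
    moreover have "\<bar>real_of_int n\<bar> * Im T \<ge> Im T" if "\<bar>n\<bar> \<ge> 1"
      using that mT mult_right_mono[of 1 "\<bar>real_of_int n\<bar>" "Im T"] by linarith
    ultimately show False using mT by force
  qed
  \<comment> \<open>The regular part of \<open>\<phi> * A\<close>. Being holomorphic and 1-periodic
    on the strip it integrates equally over both lines, so the jump comes from
    \<open>\<phi> z * k\<close> alone, where \<open>k\<close> integrates to -1 below and 0
    above.\<close>
  define G where "G = (\<lambda>u. g u + \<phi> u * A0 u)"
  have G_holo: "G holomorphic_on S"
    unfolding G_def using g A0_holo holo by (intro holomorphic_intros) (auto intro: holomorphic_on_subset)
  have w_S: "u \<in> S" if "Im u = Im w \<or> Im u = Im (w + T)" for u
    using that w by (auto simp: S_def)
  have pointwise: "\<phi> u * A u = G u + \<phi> z * k u" if u: "Im u = Im w \<or> Im u = Im (w + T)" for u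
  proof -
    have "A u = k u + A0 u"
      using lerch_sum_split[OF mT generic[OF u], of "2 * of_nat m * z" 0]
      by (simp add: A_def A0_def k_def lerch_term_def)
    moreover have "u \<in> S - P"
      using w_S[OF u] generic[OF u, of 0] P_iff by auto
    ultimately show ?thesis using g(2)[of u] by (simp add: G_def q_def algebra_simps)
  qed
  have conts: "continuous_on {u. Im u = Im a} G" "continuous_on {u. Im u = Im a} (\<lambda>u. \<phi> z * k u)"
    if a: "Im a = Im w \<or> Im a = Im (w + T)" for a
  proof -
    show "continuous_on {u. Im u = Im a} G"
      using a w_S by (intro holomorphic_on_imp_continuous_on[OF holomorphic_on_subset[OF G_holo]]) auto
    have "ee (z - u) \<noteq> 1" if "Im u = Im a" for u
      using generic[of u 0] a that by simp
    then show "continuous_on {u. Im u = Im a} (\<lambda>u. \<phi> z * k u)"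
      unfolding k_def by (intro continuous_intros) auto
  qed
  have decomp: "period_integral a (\<lambda>u. \<phi> u * A u) = period_integral a G + \<phi> z * period_integral a k"
    if a: "Im a = Im w \<or> Im a = Im (w + T)" for a
  proof -
    have "period_integral a (\<lambda>u. \<phi> u * A u) = period_integral a (\<lambda>u. G u + \<phi> z * k u)"
      using a by (intro period_integral_cong pointwise) simp
    then show ?thesis by (simp add: period_integral_cmult period_integral_add conts[OF a])
  qed
  \<comment> \<open>The kernel lemmas are stated for u - z, the negative of the argument in
    \<open>k\<close>; 1/(x - 1) = -(1/x)/((1/x) - 1) translates.\<close>
  have k_int: "period_integral a k = - period_integral (a - z) (\<lambda>v. ee v / (ee v - 1))"
    if a: "Im a = Im w \<or> Im a = Im (w + T)" for a
  proof -
    have "period_integral a k = period_integral a (\<lambda>u. (-1) * (ee (u - z) / (ee (u - z) - 1)))"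
    proof (rule period_integral_cong)
      fix u assume u: "Im u = Im a"
      then have "ee (z - u) \<noteq> 1" using generic[of u 0] a by auto
      have *: "(-1) * (inverse x / (inverse x - 1)) = 1 / (x - 1)" if "x \<noteq> 0" "x \<noteq> 1" for x :: complex
        using that by (simp add: field_simps)
      have e: "ee (u - z) = inverse (ee (z - u))" using ee_minus[of "z - u"] by simp
      show "k u = (-1) * (ee (u - z) / (ee (u - z) - 1))"
        unfolding e k_def using \<open>ee (z - u) \<noteq> 1\<close> by (intro *[symmetric]) auto
    qed
    also have "\<dots> = - period_integral a (\<lambda>u. ee (u - z) / (ee (u - z) - 1))"
      by (subst period_integral_cmult) simp
    also have "period_integral a (\<lambda>u. ee (u - z) / (ee (u - z) - 1)) = period_integral (a - z) (\<lambda>v. ee v / (ee v - 1))"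
      using period_integral_shift[of a "- z"] by simp
    finally show ?thesis .
  qed
  have "period_integral (w + T) (\<lambda>u. \<phi> u * A u) = period_integral w (\<lambda>u. \<phi> (u + T) * A (u + T))"
    by (rule period_integral_shift)
  also have "\<dots> = period_integral w (\<lambda>u. \<phi> u * A u
      + (\<Sum>j<2*m. theta_coeff m T j z * (\<phi> u * ee (- of_nat j * u))))"
  proof (rule period_integral_cong)
    fix u assume u: "Im u = Im w"
    have "\<phi> (u + T) * A (u + T) = \<phi> u * (ee (- (of_nat m * T + 2 * of_nat m * u)) * A (u + T))"
      by (simp only: quasi mult_ac)
    also have "\<dots> = \<phi> u * (A u + (\<Sum>j<2*m. ee (- of_nat j * u) * theta_coeff m T j z))"
      unfolding A_def lerch_sum_quasi_period[OF mT generic[OF disjI1[OF u]]] ..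
    finally show "\<phi> (u + T) * A (u + T)
        = \<phi> u * A u + (\<Sum>j<2*m. theta_coeff m T j z * (\<phi> u * ee (- of_nat j * u)))"
      by (simp add: distrib_left sum_distrib_left mult_ac)
  qed
  also have "\<dots> = period_integral w (\<lambda>u. \<phi> u * A u)
      + (\<Sum>j<2*m. period_integral w (\<lambda>u. theta_coeff m T j z * (\<phi> u * ee (- of_nat j * u))))"
  proof -
    have "continuous_on {u. Im u = Im w} (\<lambda>u. G u + \<phi> z * k u)"
      by (intro continuous_on_add conts) auto
    moreover have "continuous_on {u. Im u = Im w} (\<lambda>u. \<phi> u * A u) \<longleftrightarrow>
        continuous_on {u. Im u = Im w} (\<lambda>u. G u + \<phi> z * k u)"
      by (intro continuous_on_cong refl pointwise) auto
    ultimately have "continuous_on {u. Im u = Im w} (\<lambda>u. \<phi> u * A u)" by blast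
    then show ?thesis
      by (subst period_integral_add)
         (auto intro!: continuous_intros cont period_integral_sum)
  qed
  finally have eq: "period_integral (w + T) (\<lambda>u. \<phi> u * A u) = period_integral w (\<lambda>u. \<phi> u * A u)
      + (\<Sum>j<2*m. theta_coeff m T j z * period_integral w (\<lambda>u. \<phi> u * ee (- of_nat j * u)))"
    by (simp add: period_integral_cmult)
  have "period_integral (w + T) G = period_integral w G"
    using g1 A01 per S1 w
    by (intro period_integral_independent[OF S(2,1) G_holo]) (auto simp: G_def)
  moreover have "period_integral w k = -1" "period_integral (w + T) k = 0"
    using k_int[of w] k_int[of "w + T"] period_integral_lower_1[OF w(3)]
      period_integral_upper[OF w(4), of 1] by simp_all
  ultimately have "period_integral (w + T) (\<lambda>u. \<phi> u * A u) = period_integral w (\<lambda>u. \<phi> u * A u) + \<phi> z"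
    using decomp[of w] decomp[of "w + T"] by simp
  with eq have "\<phi> z = (\<Sum>j<2*m. theta_coeff m T j z * period_integral w (\<lambda>u. \<phi> u * ee (- of_nat j * u)))"
    by (simp only: add_left_cancel)
  also have "\<dots> = (\<Sum>j<2*m. theta_coeff m T j z * period_integral (b j) (\<lambda>u. \<phi> u * ee (- of_nat j * u)))"
  proof (intro sum.cong refl arg_cong[of _ _ "(*) _"] period_integral_independent[of UNIV])
    fix j u
    have "ee (- of_nat j * (u + 1)) = ee (- of_nat j * u)"
      using ee_plus_of_int[of "- of_nat j * u" "- int j"] by (simp add: algebra_simps)
    then show "u + 1 \<in> UNIV \<and> \<phi> (u + 1) * ee (- of_nat j * (u + 1)) = \<phi> u * ee (- of_nat j * u)"
      using per by simp
  qed (use holo in \<open>auto intro!: holomorphic_intros\<close>)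
  finally show ?thesis .
qed

section \<open>The polar part\<close>

text \<open>With w_n = \<open>ee (n * T + z - x)\<close> the summands are
  \<open>ee (m * n^2 * T + 2 * m * n * z)\<close> times w_n^p / (w_n - 1). The part of w_n^p free of
  n stands in front, the rest is the \<open>p * T\<close> inside the first argument.\<close>

definition appell :: "nat \<Rightarrow> complex \<Rightarrow> int \<Rightarrow> complex \<Rightarrow> complex \<Rightarrow> complex" where
  "appell m T p x z = ee (of_int p * (z - x)) * lerch_sum m T UNIV (2 * of_nat m * z + of_int p * T) (z - x)"

lemma appell_holomorphic:
  assumes "m \<ge> 1" "Im T > 0" "open S" "\<And>z n. z \<in> S \<Longrightarrow> ee (of_int n * T + (z - x)) \<noteq> 1"
  shows "appell m T p x holomorphic_on S"
  unfolding appell_def[abs_def] using assms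
  by (intro holomorphic_intros lerch_sum_holomorphic) auto

lemma appell_plus_1: "appell m T p x (z + 1) = appell m T p x z"
proof -
  have "lerch_term m T (2 * of_nat m * (z + 1) + of_int p * T) (z + 1 - x) n
      = lerch_term m T (2 * of_nat m * z + of_int p * T) (z - x) n" for n
  proof -
    have "of_nat m * of_int n ^ 2 * T + of_int n * (2 * of_nat m * (z + 1) + of_int p * T)
        = (of_nat m * of_int n ^ 2 * T + of_int n * (2 * of_nat m * z + of_int p * T))
          + of_int (n * (2 * int m))"
      by (simp add: algebra_simps)
    moreover have "of_int n * T + (z + 1 - x) = (of_int n * T + (z - x)) + 1" by simp
    ultimately show ?thesis unfolding lerch_term_def by (simp only: ee_plus_of_int ee_plus_1)
  qed
  moreover have "ee (of_int p * (z + 1 - x)) = ee (of_int p * (z - x))"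
    using ee_plus_of_int[of "of_int p * (z - x)" p] by (simp add: algebra_simps)
  ultimately show ?thesis by (simp add: appell_def lerch_sum_def)
qed

text \<open>The index shift n + 1 matches numerators and denominators separately, so the identity
  holds at the poles as well, with x / 0 = 0; reindexing and constant factors are unconditional for
  \<open>infsum\<close> here.\<close>

lemma appell_quasi_period:
  "appell m T p x (z + T) = ee (- (of_nat m * T + 2 * of_nat m * z)) * appell m T p x z"
proof -
  define a where "a = 2 * of_nat m * z + of_int p * T"
  have "ee (of_int p * (z + T - x)) * lerch_term m T (a + 2 * of_nat m * T) (z + T - x) n
      = ee (- (of_nat m * T + 2 * of_nat m * z)) * (ee (of_int p * (z - x)) * lerch_term m T a (z - x) (n + 1))"
    for n
  proof -
    have "of_int p * (z + T - x) + (of_nat m * of_int n ^ 2 * T + of_int n * (a + 2 * of_nat m * T))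
        = - (of_nat m * T + 2 * of_nat m * z) + (of_int p * (z - x)
           + (of_nat m * of_int (n + 1) ^ 2 * T + of_int (n + 1) * a))"
      by (simp add: a_def algebra_simps power2_eq_square)
    moreover have "of_int n * T + (z + T - x) = of_int (n + 1) * T + (z - x)"
      by (simp add: algebra_simps)
    ultimately show ?thesis
      unfolding lerch_term_def times_divide_eq_right by (simp only: ee_add[symmetric])
  qed
  then have "appell m T p x (z + T) = (\<Sum>\<^sub>\<infinity>n. ee (- (of_nat m * T + 2 * of_nat m * z))
      * (ee (of_int p * (z - x)) * lerch_term m T a (z - x) (n + 1)))"
    by (simp add: appell_def lerch_sum_def a_def algebra_simps flip: infsum_cmult_right')
  also have "\<dots> = ee (- (of_nat m * T + 2 * of_nat m * z))
      * (ee (of_int p * (z - x)) * (\<Sum>\<^sub>\<infinity>n. lerch_term m T a (z - x) (n + 1)))"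
    by (simp only: infsum_cmult_right')
  also have "bij_betw (\<lambda>n::int. n + 1) UNIV UNIV"
    by (rule bij_betwI[where g = "\<lambda>n. n - 1"]) auto
  then have "(\<Sum>\<^sub>\<infinity>n. lerch_term m T a (z - x) (n + 1)) = lerch_sum m T UNIV a (z - x)"
    unfolding lerch_sum_def by (rule infsum_reindex_bij_betw)
  finally show ?thesis by (simp add: appell_def a_def)
qed

text \<open>Near x only the summand n = 0 is singular, and its numerator equals 1 at x; hence the
  limit does not depend on \<open>p\<close>.\<close>

lemma appell_pole:
  assumes mT: "m \<ge> 1" "Im T > 0"
  shows "((\<lambda>z. (z - x) * appell m T p x z) \<longlongrightarrow> 1 / (2 * of_real pi * \<i>)) (at x)"
proof -
  define A0 where "A0 = (\<lambda>z. lerch_sum m T (- {0}) (2 * of_nat m * z + of_int p * T) (z - x))"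
  \<comment> \<open>The bound 1 keeps out the translates of x by nonzero integers, the bound Im T
    those that involve a nonzero multiple of T.\<close>
  define r where "r = min 1 (Im T)"
  have r: "r > 0" using mT by (simp add: r_def)
  have small: "n = 0 \<and> z = x" if z: "z \<in> ball x r" and e: "ee (of_int n * T + (z - x)) = 1" for n z
  proof
    have Im: "\<bar>Im (z - x)\<bar> < Im T"
      using z abs_Im_le_cmod[of "z - x"] by (simp add: r_def dist_norm norm_minus_commute)
    show n: "n = 0"
    proof (rule ccontr)
      assume "n \<noteq> 0"
      then have "\<bar>real_of_int n\<bar> \<ge> 1" by auto
      then have "\<bar>real_of_int n\<bar> * Im T \<ge> Im T" using mT by simp
      then show False using ee_lattice_eq_1_imp[OF mT(2) e] Im by linarith
    qed
    then obtain k :: int where k: "z - x = of_int k" using e by (auto simp: ee_eq_1_iff)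
    have "norm (z - x) < 1" using z by (simp add: r_def dist_norm norm_minus_commute)
    then have "\<bar>real_of_int k\<bar> < 1" using k by simp
    then have "k = 0" by linarith
    then show "z = x" using k by simp
  qed
  have "A0 holomorphic_on ball x r"
    unfolding A0_def using small by (intro lerch_sum_holomorphic mT holomorphic_intros) auto
  then have A0: "(A0 \<longlongrightarrow> A0 x) (at x)"
    using r by (metis centre_in_ball continuous_on_interior holomorphic_on_imp_continuous_on
        interior_ball isCont_def)
  have "((\<lambda>z. z - x) has_field_derivative 1) (at x)"
    by (auto intro!: derivative_eq_intros)
  from ee_simple_pole[OF this]
  have pole: "((\<lambda>z. (z - x) / (ee (z - x) - 1)) \<longlongrightarrow> 1 / (2 * of_real pi * \<i>)) (at x)" by simp
  have "((\<lambda>z. ee (of_int p * (z - x)) * ((z - x) / (ee (z - x) - 1) + (z - x) * A0 z))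
      \<longlongrightarrow> ee (of_int p * (x - x)) * (1 / (2 * of_real pi * \<i>) + (x - x) * A0 x)) (at x)"
    by (intro tendsto_intros pole A0)
  then have "((\<lambda>z. ee (of_int p * (z - x)) * ((z - x) / (ee (z - x) - 1) + (z - x) * A0 z))
      \<longlongrightarrow> 1 / (2 * of_real pi * \<i>)) (at x)" by simp
  then show ?thesis
  proof (rule Lim_transform_eventually)
    have "eventually (\<lambda>z. z \<in> ball x r - {x}) (at x)"
      using eventually_at_in_open[of "ball x r" x] r by simp
    then show "eventually (\<lambda>z. ee (of_int p * (z - x)) * ((z - x) / (ee (z - x) - 1) + (z - x) * A0 z)
        = (z - x) * appell m T p x z) (at x)"
    proof eventually_elim
      case (elim z)
      then have "ee (of_int n * T + (z - x)) \<noteq> 1" for n using small by blast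
      from lerch_sum_split[OF mT this, of "2 * of_nat m * z + of_int p * T" 0]
      show ?case by (simp add: appell_def A0_def lerch_term_def algebra_simps)
    qed
  qed
qed

text \<open>Uniform convergence on the segment allows termwise integration; the substitution v = n T
  + u - x in the n-th term then gathers all dependence on u in one exponent 2mn - l + p over the
  denominator \<open>ee v - 1\<close>.\<close>

lemma appell_integral:
  assumes mT: "m \<ge> 1" "Im T > 0" and ne: "\<And>n. Im (of_int n * T + (a - x)) \<noteq> 0"
  shows "period_integral a (\<lambda>u. appell m T p x u * ee (- of_int l * u)) =
    (\<Sum>\<^sub>\<infinity>n. ee (of_nat m * of_int n ^ 2 * T + of_int (2 * int m * n - l) * (x - of_int n * T))
      * period_integral (of_int n * T + (a - x)) (\<lambda>v. ee (of_int (2 * int m * n - l + p) * v) / (ee v - 1)))"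
proof -
  define h where "h = (\<lambda>u. ee (of_int p * (u - x)) * ee (- of_int l * u))"
  define f where "f = (\<lambda>n u. lerch_term m T (2 * of_nat m * u + of_int p * T) (u - x) n)"
  have ne1: "ee (of_int n * T + (u - x)) \<noteq> 1" if "Im u = Im a" for n u
    using ne[of n] that by (intro ee_neq_1) simp
  have K: "closed_segment a (a + 1) \<subseteq> {u. Im u = Im a}" by (auto dest: Im_segment)
  have h_cont: "continuous_on X h" for X
    unfolding h_def by (intro continuous_intros)
  have ul: "uniform_limit (closed_segment a (a + 1)) (\<lambda>X u. \<Sum>n\<in>X. f n u)
      (\<lambda>u. lerch_sum m T UNIV (2 * of_nat m * u + of_int p * T) (u - x)) (finite_subsets_at_top UNIV)"
    unfolding f_def using ne1 K
    by (intro lerch_sum_uniform_limit mT continuous_intros) auto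
  have f_cont: "continuous_on {u. Im u = Im a} (f n)" for n
    unfolding f_def lerch_term_def using ne1 by (intro continuous_intros) auto
  have "uniform_limit (closed_segment a (a + 1)) (\<lambda>X u. h u * (\<Sum>n\<in>X. f n u))
      (\<lambda>u. h u * lerch_sum m T UNIV (2 * of_nat m * u + of_int p * T) (u - x)) (finite_subsets_at_top UNIV)"
  proof (intro uniform_lim_mult uniform_limit_const)
    show "bounded (h ` closed_segment a (a + 1))"
      by (intro compact_imp_bounded compact_continuous_image h_cont compact_segment)
    have "continuous_on (closed_segment a (a + 1))
        (\<lambda>u. lerch_sum m T UNIV (2 * of_nat m * u + of_int p * T) (u - x))"
      using ul by (rule uniform_limit_theorem[rotated])
        (auto intro!: eventually_finite_subsets_at_top_weakI continuous_on_sum continuous_on_subset[OF f_cont K])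
    then show "bounded ((\<lambda>u. lerch_sum m T UNIV (2 * of_nat m * u + of_int p * T) (u - x)) ` closed_segment a (a + 1))"
      by (intro compact_imp_bounded compact_continuous_image compact_segment)
  qed (rule ul)
  then have "uniform_limit (closed_segment a (a + 1)) (\<lambda>X u. \<Sum>n\<in>X. h u * f n u)
      (\<lambda>u. \<Sum>\<^sub>\<infinity>n. h u * f n u) (finite_subsets_at_top UNIV)"
    by (simp add: sum_distrib_left lerch_sum_def f_def infsum_cmult_right')
  then have "period_integral a (\<lambda>u. \<Sum>\<^sub>\<infinity>n. h u * f n u) = (\<Sum>\<^sub>\<infinity>n. period_integral a (\<lambda>u. h u * f n u))"
    by (rule period_integral_infsum) (intro continuous_on_mult h_cont f_cont)
  moreover have "appell m T p x u * ee (- of_int l * u) = (\<Sum>\<^sub>\<infinity>n. h u * f n u)" for u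
    by (simp add: appell_def h_def f_def lerch_sum_def infsum_cmult_right')
  moreover have "period_integral a (\<lambda>u. h u * f n u) =
      ee (of_nat m * of_int n ^ 2 * T + of_int (2 * int m * n - l) * (x - of_int n * T))
      * period_integral (of_int n * T + (a - x)) (\<lambda>v. ee (of_int (2 * int m * n - l + p) * v) / (ee v - 1))" for n
  proof -
    have "of_int n * T + (a - x) = a + (of_int n * T - x)" by simp
    then have "period_integral (of_int n * T + (a - x)) (\<lambda>v. ee (of_int (2 * int m * n - l + p) * v) / (ee v - 1))
       = period_integral a (\<lambda>u. ee (of_int (2 * int m * n - l + p) * (u + (of_int n * T - x))) / (ee (u + (of_int n * T - x)) - 1))"
      by (simp only: period_integral_shift)
    moreover have "h u * f n u = ee (of_nat m * of_int n ^ 2 * T + of_int (2 * int m * n - l) * (x - of_int n * T))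
      * (ee (of_int (2 * int m * n - l + p) * (u + (of_int n * T - x))) / (ee (u + (of_int n * T - x)) - 1))" for u
    proof -
      have "of_int p * (u - x) + - of_int l * u + (of_nat m * of_int n ^ 2 * T + of_int n * (2 * of_nat m * u + of_int p * T))
         = (of_nat m * of_int n ^ 2 * T + of_int (2 * int m * n - l) * (x - of_int n * T))
           + of_int (2 * int m * n - l + p) * (u + (of_int n * T - x))"
        by (simp add: algebra_simps power2_eq_square)
      moreover have "of_int n * T + (u - x) = u + (of_int n * T - x)" by simp
      ultimately show ?thesis
        unfolding h_def f_def lerch_term_def times_divide_eq_right by (simp only: ee_add[symmetric])
    qed
    ultimately show ?thesis by (simp only: period_integral_cmult)
  qed
  ultimately show ?thesis by simp
qed

text \<open>A translate of the integers has a smallest nonzero distance from 0. This yields one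
  range of \<epsilon> that serves all summands simultaneously.\<close>

lemma int_translate_gap:
  fixes c :: real
  obtains \<delta> where "\<delta> > 0" "\<And>r::int. of_int r + c \<noteq> 0 \<Longrightarrow> \<bar>of_int r + c\<bar> \<ge> \<delta>"
proof (cases "c \<in> \<int>")
  case True
  then obtain k :: int where k: "c = of_int k" by (auto elim: Ints_cases)
  show thesis
  proof (rule that[of 1])
    fix r :: int assume "of_int r + c \<noteq> 0"
    then have "\<bar>r + k\<bar> \<ge> 1" using k by auto
    then show "\<bar>of_int r + c\<bar> \<ge> 1" using k by linarith
  qed auto
next
  case False
  show thesis
  proof (rule that[of "min (frac c) (1 - frac c)"])
    show "min (frac c) (1 - frac c) > 0" using False frac_lt_1[of c] by (simp add: frac_gt_0_iff)
    fix r :: int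
    have "r + \<lfloor>c\<rfloor> \<ge> 0 \<or> r + \<lfloor>c\<rfloor> \<le> -1" by linarith
    moreover have "of_int r + c = of_int (r + \<lfloor>c\<rfloor>) + frac c" by (simp add: frac_def)
    ultimately show "\<bar>of_int r + c\<bar> \<ge> min (frac c) (1 - frac c)"
      using frac_ge_0[of c] frac_lt_1[of c] by linarith
  qed
qed

text \<open>\<open>Rc c w\<close> is the mean of \<open>w\<^sup>p / (w - 1)\<close> over \<open>p = \<lceil>c\<rceil>\<close> and \<open>p = \<lfloor>c\<rfloor> + 1\<close>; the two exponents
  differ only for integral \<open>c\<close>.\<close>
definition appell_pair :: "nat \<Rightarrow> complex \<Rightarrow> real \<Rightarrow> complex \<Rightarrow> complex \<Rightarrow> complex" where
  "appell_pair m T c x z = appell m T \<lceil>c\<rceil> x z + appell m T (\<lfloor>c\<rfloor> + 1) x z"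

text \<open>In the \<open>n\<close>-th term the integrand is \<open>ee ((r + p) * v) / (ee v - 1)\<close> with \<open>r = 2mn - l\<close>, on a line
  where \<open>Im v\<close> is a positive multiple of \<open>r + c\<close> plus \<open>\<epsilon>\<close>. So every term with \<open>r + c \<noteq> 0\<close> integrates
  to \<open>0\<close>, and the remaining one is odd in \<open>\<epsilon>\<close>.\<close>
lemma appell_pair_integral:
  assumes mT: "m \<ge> 1" "Im T > 0" and x: "Im x = - c * Im T / (2 * real m)"
    and w: "Im w = - of_int l * Im T / (2 * real m)"
  obtains \<epsilon>0 \<kappa> where "\<epsilon>0 > 0"
    "\<And>\<epsilon> n. 0 < \<bar>\<epsilon>\<bar> \<Longrightarrow> \<bar>\<epsilon>\<bar> < \<epsilon>0 \<Longrightarrow> Im (of_int n * T + (w + \<i> * of_real \<epsilon> - x)) \<noteq> 0"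
    "\<And>\<epsilon>. 0 < \<bar>\<epsilon>\<bar> \<Longrightarrow> \<bar>\<epsilon>\<bar> < \<epsilon>0 \<Longrightarrow>
       period_integral (w + \<i> * of_real \<epsilon>) (\<lambda>u. appell_pair m T c x u * ee (- of_int l * u)) = of_real (sgn \<epsilon>) * \<kappa>"
proof -
  \<comment> \<open>The unit of height: in the n-th term the line lies at Y (r + c) + \<epsilon>, so
    |\<epsilon>| < Y \<delta> cannot change the sign unless r + c = 0.\<close>
  define Y where "Y = Im T / (2 * real m)"
  have Y: "Y > 0" using mT by (simp add: Y_def)
  obtain \<delta> where \<delta>: "\<delta> > 0" "\<And>r::int. of_int r + c \<noteq> 0 \<Longrightarrow> \<bar>of_int r + c\<bar> \<ge> \<delta>"
    using int_translate_gap[of c] by blast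
  define r where "r = (\<lambda>n::int. 2 * int m * n - l)"
  define C where "C = (\<lambda>n::int. ee (of_nat m * of_int n ^ 2 * T + of_int (r n) * (x - of_int n * T)))"
  define I where "I = (\<lambda>\<epsilon> n p. period_integral (of_int n * T + (w + \<i> * of_real \<epsilon> - x))
      (\<lambda>v. ee (of_int (r n + p) * v) / (ee v - 1)))"
  have V: "Im (of_int n * T + (w + \<i> * of_real \<epsilon> - x)) = Y * (of_int (r n) + c) + \<epsilon>" for n \<epsilon>
    using mT by (simp add: x w Y_def r_def field_simps)
  have pos: "Y * (of_int (r n) + c) + \<epsilon> > 0" if "of_int (r n) + c > 0" "\<bar>\<epsilon>\<bar> < Y * \<delta>" for n \<epsilon>
  proof -
    have "Y * (of_int (r n) + c) \<ge> Y * \<delta>"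
      using \<delta>(2)[of "r n"] that Y by (intro mult_left_mono) auto
    then show ?thesis using that by linarith
  qed
  have neg: "Y * (of_int (r n) + c) + \<epsilon> < 0" if "of_int (r n) + c < 0" "\<bar>\<epsilon>\<bar> < Y * \<delta>" for n \<epsilon>
  proof -
    have "Y * - (of_int (r n) + c) \<ge> Y * \<delta>"
      using \<delta>(2)[of "r n"] that Y by (intro mult_left_mono) auto
    then show ?thesis using that by (simp add: algebra_simps)
  qed
  have ne: "Im (of_int n * T + (w + \<i> * of_real \<epsilon> - x)) \<noteq> 0" if "0 < \<bar>\<epsilon>\<bar>" "\<bar>\<epsilon>\<bar> < Y * \<delta>" for \<epsilon> n
    unfolding V using pos[of n \<epsilon>] neg[of n \<epsilon>] that
    by (cases "of_int (r n) + c" "0::real" rule: linorder_cases) auto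
  \<comment> \<open>For either exponent, r + c > 0 forces r + p \<ge> 1 and r + c < 0 forces r + p
    \<le> 0, which are the vanishing conditions of the half plane in question.\<close>
  have I0: "I \<epsilon> n p = 0" if "of_int (r n) + c \<noteq> 0" "\<bar>\<epsilon>\<bar> < Y * \<delta>" "p = \<lceil>c\<rceil> \<or> p = \<lfloor>c\<rfloor> + 1" for \<epsilon> n p
  proof (cases "of_int (r n) + c > 0")
    case True
    have "r n + p \<ge> 1" using True that(3) by linarith
    then show ?thesis
      unfolding I_def using V[of n \<epsilon>] pos[OF True that(2)] by (intro period_integral_upper) auto
  next
    case False
    then have lt: "of_int (r n) + c < 0" using that(1) by simp
    have "r n + p \<le> 0" using lt that(3) by linarith
    then show ?thesis
      unfolding I_def using V[of n \<epsilon>] neg[OF lt that(2)] by (intro period_integral_lower) auto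
  qed
  \<comment> \<open>Here c is the integer -r and the exponents r + p are 0 and 1. Their integrals
    are -1 and 0 above the line, 0 and 1 below it.\<close>
  have I1: "I \<epsilon> n \<lceil>c\<rceil> + I \<epsilon> n (\<lfloor>c\<rfloor> + 1) = - of_real (sgn \<epsilon>)"
    if n: "of_int (r n) + c = 0" and \<epsilon>: "0 < \<bar>\<epsilon>\<bar>" for \<epsilon> n
  proof -
    have c: "c = of_int (- r n)" using n by simp
    have "\<lceil>c\<rceil> = - r n" "\<lfloor>c\<rfloor> = - r n"
      unfolding c by (rule ceiling_of_int floor_of_int)+
    then have p: "r n + \<lceil>c\<rceil> = 0" "r n + (\<lfloor>c\<rfloor> + 1) = 1" by simp_all
    have Vn: "Im (of_int n * T + (w + \<i> * of_real \<epsilon> - x)) = \<epsilon>" using V[of n \<epsilon>] n by simp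
    show ?thesis
    proof (cases "\<epsilon> > 0")
      case True
      then have "I \<epsilon> n \<lceil>c\<rceil> = -1" "I \<epsilon> n (\<lfloor>c\<rfloor> + 1) = 0"
        unfolding I_def p
        using period_integral_upper_0[of "of_int n * T + (w + \<i> * of_real \<epsilon> - x)"]
          period_integral_upper[of "of_int n * T + (w + \<i> * of_real \<epsilon> - x)" 1] Vn by simp_all
      then show ?thesis using True by simp
    next
      case False
      then have "I \<epsilon> n \<lceil>c\<rceil> = 0" "I \<epsilon> n (\<lfloor>c\<rfloor> + 1) = 1"
        unfolding I_def p
        using period_integral_lower[of "of_int n * T + (w + \<i> * of_real \<epsilon> - x)" 0]
          period_integral_lower_1[of "of_int n * T + (w + \<i> * of_real \<epsilon> - x)"] Vn \<epsilon> by simp_all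
      then show ?thesis using False \<epsilon> by simp
    qed
  qed
  define J where "J = (\<lambda>\<epsilon> p. \<Sum>\<^sub>\<infinity>n. C n * I \<epsilon> n p)"
  have appell_J: "period_integral (w + \<i> * of_real \<epsilon>) (\<lambda>u. appell m T p x u * ee (- of_int l * u)) = J \<epsilon> p"
    if "0 < \<bar>\<epsilon>\<bar>" "\<bar>\<epsilon>\<bar> < Y * \<delta>" for \<epsilon> p
    unfolding J_def C_def I_def r_def by (rule appell_integral[OF mT ne[OF that]])
  have cont: "continuous_on {u. Im u = Im (w + \<i> * of_real \<epsilon>)} (\<lambda>u. appell m T p x u * ee (- of_int l * u))"
    if \<epsilon>: "0 < \<bar>\<epsilon>\<bar>" "\<bar>\<epsilon>\<bar> < Y * \<delta>" for \<epsilon> p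
  proof -
    \<comment> \<open>An open strip on one side only: the line through w itself may carry
      poles.\<close>
    define S where "S = (if \<epsilon> > 0 then {u. Im w < Im u \<and> Im u < Im w + Y * \<delta>}
        else {u. Im w - Y * \<delta> < Im u \<and> Im u < Im w})"
    have "appell m T p x holomorphic_on S"
    proof (rule appell_holomorphic[OF mT])
      show "open S" by (simp add: S_def open_Im_strip)
      fix u and n :: int assume u: "u \<in> S"
      then have "Im (of_int n * T + (w + \<i> * of_real (Im u - Im w) - x)) \<noteq> 0"
        by (intro ne) (auto simp: S_def split: if_splits)
      then show "ee (of_int n * T + (u - x)) \<noteq> 1" by (intro ee_neq_1) simp
    qed
    then have "continuous_on S (appell m T p x)" by (rule holomorphic_on_imp_continuous_on)
    moreover have "{u. Im u = Im (w + \<i> * of_real \<epsilon>)} \<subseteq> S" using \<epsilon> by (auto simp: S_def)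
    ultimately have "continuous_on {u. Im u = Im (w + \<i> * of_real \<epsilon>)} (appell m T p x)"
      by (rule continuous_on_subset)
    then show ?thesis by (intro continuous_intros)
  qed
  have pair: "period_integral (w + \<i> * of_real \<epsilon>) (\<lambda>u. appell_pair m T c x u * ee (- of_int l * u))
      = J \<epsilon> \<lceil>c\<rceil> + J \<epsilon> (\<lfloor>c\<rfloor> + 1)" if "0 < \<bar>\<epsilon>\<bar>" "\<bar>\<epsilon>\<bar> < Y * \<delta>" for \<epsilon>
    unfolding appell_pair_def distrib_right
    by (simp only: period_integral_add[OF cont[OF that] cont[OF that]] appell_J[OF that])
  show thesis
  proof (cases "\<exists>n0. of_int (r n0) + c = 0")
    case True
    then obtain n0 where n0: "of_int (r n0) + c = 0" by blast
    \<comment> \<open>The values r n advance in steps of 2m > 0, so at most one summand has its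
      poles on the prescribed line.\<close>
    have uniq: "of_int (r n) + c \<noteq> 0" if "n \<noteq> n0" for n
    proof
      assume "of_int (r n) + c = 0"
      with n0 have "r n = r n0" by linarith
      then show False using that mT by (simp add: r_def)
    qed
    have J: "J \<epsilon> p = C n0 * I \<epsilon> n0 p" if "\<bar>\<epsilon>\<bar> < Y * \<delta>" "p = \<lceil>c\<rceil> \<or> p = \<lfloor>c\<rfloor> + 1" for \<epsilon> p
    proof -
      have "J \<epsilon> p = (\<Sum>\<^sub>\<infinity>n\<in>{n0}. C n * I \<epsilon> n p)"
        unfolding J_def using I0[OF uniq that] by (intro infsum_cong_neutral) auto
      then show ?thesis by simp
    qed
    show thesis
    proof (rule that[of "Y * \<delta>" "- C n0"])
      fix \<epsilon> :: real assume \<epsilon>: "0 < \<bar>\<epsilon>\<bar>" "\<bar>\<epsilon>\<bar> < Y * \<delta>"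
      have "J \<epsilon> \<lceil>c\<rceil> + J \<epsilon> (\<lfloor>c\<rfloor> + 1) = C n0 * (I \<epsilon> n0 \<lceil>c\<rceil> + I \<epsilon> n0 (\<lfloor>c\<rfloor> + 1))"
        using J[OF \<epsilon>(2)] by (simp add: distrib_left)
      then show "period_integral (w + \<i> * of_real \<epsilon>) (\<lambda>u. appell_pair m T c x u * ee (- of_int l * u))
          = of_real (sgn \<epsilon>) * (- C n0)"
        unfolding pair[OF \<epsilon>] I1[OF n0 \<epsilon>(1)] by simp
    qed (use Y \<delta> ne in auto)
  next
    case False
    have J: "J \<epsilon> p = 0" if "\<bar>\<epsilon>\<bar> < Y * \<delta>" "p = \<lceil>c\<rceil> \<or> p = \<lfloor>c\<rfloor> + 1" for \<epsilon> p
      unfolding J_def using I0[OF _ that] False by simp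
    show thesis
      by (rule that[of "Y * \<delta>" 0]) (use Y \<delta> ne pair J in auto)
  qed
qed

lemma quasi_period_iterate:
  assumes 1: "\<And>z. F (z + 1) = F z"
    and T: "\<And>z. F (z + T) = ee (- (of_nat m * T + 2 * of_nat m * z)) * F z"
  shows "F (z + of_int l * T + of_int \<mu>) = ee (- (of_nat m * of_int l ^ 2 * T + 2 * of_nat m * of_int l * z)) * F z"
proof -
  have "F (z + of_int \<mu>) = F z" for z
  proof (induction \<mu> rule: int_induct[where k = 0])
    case (step1 i)
    then show ?case using 1[of "z + of_int i"] by (simp add: add_ac)
  next
    case (step2 i)
    then show ?case using 1[of "z + of_int (i - 1)"] by (simp add: add_ac)
  qed auto
  moreover have "F (z + of_int l * T) = ee (- (of_nat m * of_int l ^ 2 * T + 2 * of_nat m * of_int l * z)) * F z"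
  proof (induction l rule: int_induct[where k = 0])
    case (step1 l)
    have "F (z + of_int (l + 1) * T) = ee (- (of_nat m * T + 2 * of_nat m * (z + of_int l * T))) * F (z + of_int l * T)"
      using T[of "z + of_int l * T"] by (simp add: algebra_simps)
    also have "\<dots> = ee (- (of_nat m * T + 2 * of_nat m * (z + of_int l * T))
        + - (of_nat m * of_int l ^ 2 * T + 2 * of_nat m * of_int l * z)) * F z"
      by (simp only: step1 ee_add mult.assoc)
    also have "- (of_nat m * T + 2 * of_nat m * (z + of_int l * T))
        + - (of_nat m * of_int l ^ 2 * T + 2 * of_nat m * of_int l * z)
        = - (of_nat m * of_int (l + 1) ^ 2 * T + 2 * of_nat m * of_int (l + 1) * z)"
      by (simp add: algebra_simps power2_eq_square)
    finally show ?case .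
  next
    case (step2 l)
    let ?z = "z + of_int (l - 1) * T"
    have "F ?z = ee (of_nat m * T + 2 * of_nat m * ?z) * (ee (- (of_nat m * T + 2 * of_nat m * ?z)) * F ?z)"
      by (simp add: mult.assoc[symmetric] flip: ee_add)
    also have "ee (- (of_nat m * T + 2 * of_nat m * ?z)) * F ?z = F (z + of_int l * T)"
      unfolding T[symmetric] by (simp add: algebra_simps)
    also have "ee (of_nat m * T + 2 * of_nat m * ?z) * F (z + of_int l * T)
        = ee (of_nat m * T + 2 * of_nat m * ?z + - (of_nat m * of_int l ^ 2 * T + 2 * of_nat m * of_int l * z)) * F z"
      by (simp only: step2 ee_add mult.assoc)
    also have "of_nat m * T + 2 * of_nat m * ?z + - (of_nat m * of_int l ^ 2 * T + 2 * of_nat m * of_int l * z)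
        = - (of_nat m * of_int (l - 1) ^ 2 * T + 2 * of_nat m * of_int (l - 1) * z)"
      by (simp add: algebra_simps power2_eq_square)
    finally show ?case .
  qed auto
  ultimately show ?thesis by simp
qed

lemma appell_pair_shift:
  "appell_pair m T c x (z + of_int l * T + of_int \<mu>)
     = ee (- (of_nat m * of_int l ^ 2 * T + 2 * of_nat m * of_int l * z)) * appell_pair m T c x z"
  by (rule quasi_period_iterate)
     (simp_all add: appell_pair_def appell_plus_1 appell_quasi_period distrib_left)

lemma appell_pair_pole:
  assumes "m \<ge> 1" "Im T > 0"
  shows "((\<lambda>z. (z - x) * appell_pair m T c x z) \<longlongrightarrow> 1 / (of_real pi * \<i>)) (at x)"
  using tendsto_add[OF appell_pole[OF assms, of x "\<lceil>c\<rceil>"] appell_pole[OF assms, of x "\<lfloor>c\<rfloor> + 1"]]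
  by (simp add: appell_pair_def distrib_left mult.commute[of \<i>])

lemma appell_pair_holomorphic:
  assumes "m \<ge> 1" "Im T > 0" "open S" "\<And>z n. z \<in> S \<Longrightarrow> ee (of_int n * T + (z - x)) \<noteq> 1"
  shows "appell_pair m T c x holomorphic_on S"
  unfolding appell_pair_def[abs_def] by (intro holomorphic_intros appell_holomorphic assms)

section \<open>Translation of \<open>Atilde\<close> and \<open>theta\<close> into the sums studied
  above\<close>

lemma Rc_eq:
  assumes "w \<noteq> 0"
  shows "Rc c w = (w powi \<lceil>c\<rceil> / (w - 1) + w powi (\<lfloor>c\<rfloor> + 1) / (w - 1)) / 2"
proof (cases "c \<in> \<int>")
  case True
  then have "\<lceil>c\<rceil> = \<lfloor>c\<rfloor>" by (auto elim: Ints_cases)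
  then show ?thesis
    using True assms
    by (simp add: Rc_def power_int_add distrib_left distrib_right mult.commute flip: add_divide_distrib)
next
  case False
  then have "\<lceil>c\<rceil> = \<lfloor>c\<rfloor> + 1" by (simp add: ceiling_altdef) (metis Ints_of_int)
  moreover have "(a + a) / 2 = a" for a :: complex by simp
  ultimately show ?thesis using False by (simp only: Rc_def if_False)
qed

text \<open>Off the poles the sums for the two exponents converge separately, so the mean in each
  term becomes the mean of two Appell sums.\<close>

lemma Atilde_eq:
  fixes N m s \<tau> z
  defines "T \<equiv> of_nat N * \<tau>" and "c \<equiv> - 2 * real m * fst s / real N"
  assumes m: "m \<ge> 1" and T: "Im T > 0" and ne: "\<And>n. ee (of_int n * T + (z - zs s \<tau>)) \<noteq> 1"
  shows "Atilde N m s \<tau> z = ee (- (of_nat m / of_nat N) * of_real (fst s) * zs s \<tau>)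
           * (appell_pair m T c (zs s \<tau>) z / 2)"
proof -
  define v where "v = z - zs s \<tau>"
  define t where "t = (\<lambda>p n. ee (of_int p * v) * lerch_term m T (2 * of_nat m * z + of_int p * T) v n)"
  have t: "ee (of_nat m * of_nat N * of_int n ^ 2 * \<tau>) * ee (2 * of_nat m * of_int n * z)
      * (ee (of_nat N * of_int n * \<tau>) * ee z / ee (zs s \<tau>)) powi p
      / (ee (of_nat N * of_int n * \<tau>) * ee z / ee (zs s \<tau>) - 1) = t p n" for p n
  proof -
    have w: "ee (of_nat N * of_int n * \<tau>) * ee z / ee (zs s \<tau>) = ee (of_int n * T + v)"
      by (simp add: v_def T_def ee_add ee_diff mult_ac)
    have "of_int p * v + (of_nat m * of_int n ^ 2 * T + of_int n * (2 * of_nat m * z + of_int p * T))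
       = of_nat m * of_nat N * of_int n ^ 2 * \<tau> + 2 * of_nat m * of_int n * z + of_int p * (of_int n * T + v)"
      by (simp add: T_def algebra_simps)
    then show ?thesis
      unfolding w t_def lerch_term_def times_divide_eq_right ee_of_int_mult[symmetric]
      by (simp only: ee_add[symmetric])
  qed
  have summ: "t p summable_on UNIV" for p
    unfolding t_def v_def by (intro summable_on_cmult_right lerch_term_summable m T ne)
  have sum_t: "infsum (t p) UNIV = appell m T p (zs s \<tau>) z" for p
    by (simp add: t_def appell_def lerch_sum_def v_def infsum_cmult_right')
  have eq: "ee (of_nat m * of_nat N * of_int n ^ 2 * \<tau>) * ee (2 * of_nat m * of_int n * z)
          * Rc c (ee (of_nat N * of_int n * \<tau>) * ee z / ee (zs s \<tau>))
      = (t \<lceil>c\<rceil> n + t (\<lfloor>c\<rfloor> + 1) n) / 2" for n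
    unfolding t[symmetric] by (subst Rc_eq) (simp_all add: distrib_left add_divide_distrib)
  have "(\<Sum>\<^sub>\<infinity>n. ee (of_nat m * of_nat N * of_int n ^ 2 * \<tau>) * ee (2 * of_nat m * of_int n * z)
          * Rc c (ee (of_nat N * of_int n * \<tau>) * ee z / ee (zs s \<tau>)))
      = (\<Sum>\<^sub>\<infinity>n. (1/2) * (t \<lceil>c\<rceil> n + t (\<lfloor>c\<rfloor> + 1) n))"
    by (intro infsum_cong) (simp only: eq mult.commute[of "1/2"] times_divide_eq_right mult_1_right)
  also have "\<dots> = appell_pair m T c (zs s \<tau>) z / 2"
    by (simp only: infsum_cmult_right' infsum_add[OF summ summ] sum_t appell_pair_def) simp
  finally show ?thesis by (simp add: Atilde_def c_def)
qed

lemma theta_eq: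
  assumes "m \<ge> 1"
  shows "theta m (int j) T z = ee (of_nat j ^ 2 / (4 * of_nat m) * T) * theta_coeff m T j z"
proof -
  have bij: "bij_betw (\<lambda>n. int j + 2 * int m * n) UNIV {r. r mod (2 * int m) = int j mod (2 * int m)}"
  proof (rule bij_betwI[where g = "\<lambda>r. (r - int j) div (2 * int m)"])
    show "(\<lambda>r. (r - int j) div (2 * int m)) \<in> {r. r mod (2 * int m) = int j mod (2 * int m)} \<rightarrow> UNIV" by simp
    fix r assume "r \<in> {r. r mod (2 * int m) = int j mod (2 * int m)}"
    then have "2 * int m dvd r - int j" by (simp add: mod_eq_dvd_iff)
    then show "int j + 2 * int m * ((r - int j) div (2 * int m)) = r" by simp
  qed (use assms in auto)
  have "theta m (int j) T z = (\<Sum>\<^sub>\<infinity>n. ee (of_int (int j + 2 * int m * n) ^ 2 / (4 * of_nat m) * T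
          + of_int (int j + 2 * int m * n) * z))"
    unfolding theta_def by (rule infsum_reindex_bij_betw[OF bij, symmetric])
  also have "\<dots> = (\<Sum>\<^sub>\<infinity>n. ee (of_nat j ^ 2 / (4 * of_nat m) * T)
      * ee (of_nat m * of_int n ^ 2 * T + of_int n * (2 * of_nat m * z) + of_nat j * (of_int n * T + z)))"
    unfolding ee_add[symmetric]
  proof (intro infsum_cong arg_cong[of _ _ ee])
    fix n :: int
    have "(of_int (int j + 2 * int m * n) :: complex) ^ 2 / (4 * of_nat m)
        = of_nat j ^ 2 / (4 * of_nat m) + of_nat m * of_int n ^ 2 + of_int n * of_nat j"
      using assms by (simp add: field_simps power2_eq_square)
    then show "of_int (int j + 2 * int m * n) ^ 2 / (4 * of_nat m) * T + of_int (int j + 2 * int m * n) * z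
        = of_nat j ^ 2 / (4 * of_nat m) * T
          + (of_nat m * of_int n ^ 2 * T + of_int n * (2 * of_nat m * z) + of_nat j * (of_int n * T + z))"
      by (simp only: distrib_right) (simp add: algebra_simps)
  qed
  finally show ?thesis by (simp add: infsum_cmult_right' theta_coeff_def)
qed

section \<open>The elliptic law of \<psi> and the orbits of its poles\<close>

text \<open>With \<lambda> = N l, index m/N over \<tau> becomes index m for the lattice generated by
  T = N \<tau> and 1. The mixed term \<lambda>\<mu> contributes the integer -m l \<mu> and
  disappears.\<close>

lemma elliptic_transformation:
  assumes jt: "jacobi_transformation N k m \<Gamma> \<psi>" and N: "N \<ge> 1"
    and \<tau>: "Im \<tau> > 0" "z \<notin> pole_points \<psi> \<tau>"
  shows "\<psi> \<tau> (z + of_int l * (of_nat N * \<tau>) + of_int \<mu>)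
      = ee (- (of_nat m * of_int l ^ 2 * (of_nat N * \<tau>) + 2 * of_nat m * of_int l * z)) * \<psi> \<tau> z"
proof -
  have "\<psi> \<tau> (z + of_int (int N * l) * \<tau> + of_int \<mu>)
      = ee (- (of_nat m / of_nat N) * (of_int (int N * l) ^ 2 * \<tau> + 2 * of_int (int N * l) * z
          + of_int (int N * l) * of_int \<mu>)) * \<psi> \<tau> z"
    using jt \<tau> unfolding jacobi_transformation_def Let_def by blast
  also have "- (of_nat m / of_nat N) * (of_int (int N * l) ^ 2 * \<tau> + 2 * of_int (int N * l) * z
          + of_int (int N * l) * of_int \<mu>)
      = - (of_nat m * of_int l ^ 2 * (of_nat N * \<tau>) + 2 * of_nat m * of_int l * z) + of_int (- (int m * l * \<mu>))"
    using N by (simp add: field_simps power2_eq_square)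
  finally show ?thesis by (simp only: ee_plus_of_int) (simp add: mult_ac)
qed

text \<open>Multiplication by a nonvanishing entire factor and translation preserve poles. The law
  is available only off the pole set, which by discreteness is enough in a punctured
  neighbourhood.\<close>

lemma jacobi_poles_shift:
  assumes jt: "jacobi_transformation N k m \<Gamma> \<psi>" and N: "N \<ge> 1" and mp: "mero_simple_poles \<psi>"
    and s: "s \<in> jacobi_poles \<psi>"
  shows "(fst s + real N * of_int l, snd s + of_int \<mu>) \<in> jacobi_poles \<psi>"
proof -
  obtain \<tau> where \<tau>: "Im \<tau> > 0" "is_pole (\<psi> \<tau>) (zs s \<tau>)"
    using s by (auto simp: jacobi_poles_def)
  define d where "d = of_int l * (of_nat N * \<tau>) + of_int \<mu>"
  define F where "F = (\<lambda>z. ee (- (of_nat m * of_int l ^ 2 * (of_nat N * \<tau>) + 2 * of_nat m * of_int l * z)))"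
  have "F holomorphic_on UNIV" unfolding F_def by (intro holomorphic_intros)
  then have "F analytic_on {zs s \<tau>}"
    by (meson analytic_on_subset analytic_on_open open_UNIV subset_UNIV)
  then have "is_pole (\<lambda>z. F z * \<psi> \<tau> z) (zs s \<tau>)"
    using \<tau>(2) by (intro is_pole_mult_analytic_nonzero1) (auto simp: F_def)
  moreover have "eventually (\<lambda>z. F z * \<psi> \<tau> z = (\<psi> \<tau> \<circ> (+) d) z) (at (zs s \<tau>))"
  proof -
    have "\<not> zs s \<tau> islimpt pole_points \<psi> \<tau>"
      using mp \<tau>(1) unfolding mero_simple_poles_def by blast
    then have "eventually (\<lambda>z. z \<notin> pole_points \<psi> \<tau>) (at (zs s \<tau>))"
      by (simp add: islimpt_iff_eventually)
    then show ?thesis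
    proof eventually_elim
      case (elim z)
      show ?case
        using elliptic_transformation[OF jt N \<tau>(1) elim, of l \<mu>] by (simp add: F_def d_def add_ac)
    qed
  qed
  ultimately have "is_pole (\<psi> \<tau>) (zs s \<tau> + d)"
    by (subst is_pole_shift_iff[symmetric]) (auto intro: is_pole_transform)
  moreover have "zs s \<tau> + d = zs (fst s + real N * of_int l, snd s + of_int \<mu>) \<tau>"
    by (simp add: zs_def d_def algebra_simps)
  ultimately show ?thesis using \<tau>(1) by (auto simp: jacobi_poles_def)
qed

lemma equiv_lattice_rel: "equiv S (lattice_rel N S)"
proof (rule equivI)
  show "lattice_rel N S \<subseteq> S \<times> S" by (auto simp: lattice_rel_def)
  show "refl_on S (lattice_rel N S)"
    by (auto simp: refl_on_def lattice_rel_def intro!: exI[of _ "0::int"])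
  show "sym (lattice_rel N S)"
  proof (rule symI)
    fix s t assume "(s, t) \<in> lattice_rel N S"
    then obtain l \<mu> :: int where *: "s \<in> S" "t \<in> S" "t = (fst s + real N * of_int l, snd s + of_int \<mu>)"
      unfolding lattice_rel_def by blast
    then have "s = (fst t + real N * of_int (- l), snd t + of_int (- \<mu>))" by (simp add: prod_eq_iff)
    with * show "(t, s) \<in> lattice_rel N S" unfolding lattice_rel_def by blast
  qed
  show "trans (lattice_rel N S)"
  proof (rule transI)
    fix s t u assume "(s, t) \<in> lattice_rel N S" "(t, u) \<in> lattice_rel N S"
    then obtain l \<mu> l' \<mu>' :: int where *: "s \<in> S" "u \<in> S"
      "t = (fst s + real N * of_int l, snd s + of_int \<mu>)" "u = (fst t + real N * of_int l', snd t + of_int \<mu>')"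
      unfolding lattice_rel_def by blast
    then have "u = (fst s + real N * of_int (l + l'), snd s + of_int (\<mu> + \<mu>'))" by (simp add: algebra_simps)
    with * show "(s, u) \<in> lattice_rel N S" unfolding lattice_rel_def by blast
  qed
qed

lemma zs_inj: "Im \<tau> > 0 \<Longrightarrow> zs s \<tau> = zs t \<tau> \<Longrightarrow> s = t"
  by (auto simp: zs_def complex_eq_iff prod_eq_iff)

text \<open>The labels s do not depend on \<tau>, so discreteness at the single point \<i> suffices:
  every orbit meets the box [0, N] x [0, 1], whose image is bounded. Without finiteness the sum in
  \<open>psiP\<close> would be 0 by default.\<close>

lemma finite_pole_orbits:
  assumes jt: "jacobi_transformation N k m \<Gamma> \<psi>" and N: "N \<ge> 1" and mp: "mero_simple_poles \<psi>"
  shows "finite (jacobi_poles \<psi> // lattice_rel N (jacobi_poles \<psi>))"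
proof -
  define S where "S = jacobi_poles \<psi>"
  define B where "B = S \<inter> ({0..real N} \<times> {0..1})"
  have "finite B"
  proof -
    have lim: "\<not> z islimpt pole_points \<psi> \<i>" for z
      using mp unfolding mero_simple_poles_def by auto
    have "finite (cball 0 (real N + 1) \<inter> pole_points \<psi> \<i>)"
    proof (rule ccontr)
      assume "infinite (cball 0 (real N + 1) \<inter> pole_points \<psi> \<i>)"
      then obtain z where "z islimpt (cball 0 (real N + 1) \<inter> pole_points \<psi> \<i>)"
        using Heine_Borel_imp_Bolzano_Weierstrass[of "cball 0 (real N + 1)"
          "cball 0 (real N + 1) \<inter> pole_points \<psi> \<i>"] by auto
      then have "z islimpt pole_points \<psi> \<i>" by (rule islimpt_subset) auto
      with lim show False by blast
    qed
    moreover have "(\<lambda>s. zs s \<i>) ` B \<subseteq> cball 0 (real N + 1) \<inter> pole_points \<psi> \<i>"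
    proof safe
      fix a b assume ab: "(a, b) \<in> B"
      have "norm (zs (a, b) \<i>) \<le> norm (of_real a * \<i>) + norm (of_real b :: complex)"
        unfolding zs_def by (simp only: fst_conv snd_conv) (rule norm_triangle_ineq)
      also have "\<dots> \<le> real N + 1" using ab by (auto simp: B_def norm_mult)
      finally show "zs (a, b) \<i> \<in> cball 0 (real N + 1)" by simp
      show "zs (a, b) \<i> \<in> pole_points \<psi> \<i>" using ab by (auto simp: B_def S_def pole_points_def)
    qed
    ultimately have "finite ((\<lambda>s. zs s \<i>) ` B)" using finite_subset by blast
    moreover have "inj_on (\<lambda>s. zs s \<i>) B" by (rule inj_onI) (rule zs_inj[of \<i>], auto)
    ultimately show ?thesis using finite_imageD by blast
  qed
  moreover have "S // lattice_rel N S \<subseteq> (\<lambda>s. lattice_rel N S `` {s}) ` B"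
  proof
    fix X assume "X \<in> S // lattice_rel N S"
    then obtain s where s: "s \<in> S" "X = lattice_rel N S `` {s}" by (auto simp: quotient_def)
    obtain q :: int where q: "of_int q \<le> fst s / real N" "fst s / real N \<le> of_int q + 1"
      using of_int_floor_le[of "fst s / real N"] real_of_int_floor_add_one_ge[of "fst s / real N"] by blast
    define \<mu> where "\<mu> = - \<lfloor>snd s\<rfloor>"
    define t where "t = (fst s + real N * of_int (- q), snd s + of_int \<mu>)"
    have "t \<in> S" unfolding t_def S_def
      using s(1) by (intro jacobi_poles_shift[OF jt N mp]) (simp add: S_def)
    have "0 \<le> fst t" "fst t \<le> real N" using q N by (simp_all add: t_def field_simps)
    moreover have "0 \<le> snd t" "snd t \<le> 1" unfolding t_def \<mu>_def snd_conv by linarith+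
    ultimately have "t \<in> B" using \<open>t \<in> S\<close> by (simp add: B_def mem_Times_iff)
    moreover have "(s, t) \<in> lattice_rel N S"
      using s(1) \<open>t \<in> S\<close> unfolding lattice_rel_def t_def by blast
    then have "X = lattice_rel N S `` {t}"
      using s(2) equiv_class_eq[OF equiv_lattice_rel] by blast
    ultimately show "X \<in> (\<lambda>s. lattice_rel N S `` {s}) ` B" by blast
  qed
  ultimately show ?thesis unfolding S_def using finite_surj by blast
qed

section \<open>The decomposition\<close>

text \<open>If the integral is constant on each side of the line, both one-sided limits are those
  constants, and the part odd in \<epsilon> drops out of their mean.\<close>

lemma hcoef_eq:
  fixes N m \<psi> l \<tau>
  defines "w \<equiv> - (of_int l * of_nat N / (2 * of_nat m)) * \<tau>"
  assumes "\<epsilon>0 > 0"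
    and seg: "\<And>\<epsilon>. 0 < \<bar>\<epsilon>\<bar> \<Longrightarrow> \<bar>\<epsilon>\<bar> < \<epsilon>0 \<Longrightarrow>
      period_integral (w + \<i> * of_real \<epsilon>) (\<lambda>u. \<psi> \<tau> u * ee (- of_int l * u)) = H + of_real (sgn \<epsilon>) * K"
  shows "hcoef N m \<psi> l \<tau> = ee (- (of_int l ^ 2 * of_nat N / (4 * of_nat m)) * \<tau>) * H"
proof -
  have seg': "seg_integral \<psi> l \<tau> w \<epsilon> = H + of_real (sgn \<epsilon>) * K" if "0 < \<bar>\<epsilon>\<bar>" "\<bar>\<epsilon>\<bar> < \<epsilon>0" for \<epsilon>
    using seg[OF that] by (simp add: seg_integral_def period_integral_def add_ac)
  have "eventually (\<lambda>\<epsilon>. seg_integral \<psi> l \<tau> w \<epsilon> = H + K) (at_right 0)"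
    using assms(2) by (intro eventually_at_rightI[of 0 \<epsilon>0]) (auto simp: seg')
  then have R: "Lim (at_right 0) (seg_integral \<psi> l \<tau> w) = H + K"
    by (intro tendsto_Lim tendsto_eventually) auto
  have "eventually (\<lambda>\<epsilon>. seg_integral \<psi> l \<tau> w \<epsilon> = H - K) (at_left 0)"
    using assms(2) by (intro eventually_at_leftI[of "- \<epsilon>0" 0]) (auto simp: seg')
  then have L: "Lim (at_left 0) (seg_integral \<psi> l \<tau> w) = H - K"
    by (intro tendsto_Lim tendsto_eventually) auto
  show ?thesis
    unfolding hcoef_def Let_def w_def[symmetric] R L by simp
qed

theorem theorem4p4:
  fixes N m :: nat and k :: int
    and \<Gamma> :: "(int \<times> int \<times> int \<times> int) set"
    and \<psi> :: "complex \<Rightarrow> complex \<Rightarrow> complex"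
  assumes "N \<ge> 1" and "m \<ge> 1"
    and "\<Gamma> = Gamma0 N \<or> \<Gamma> = Gamma1 N"
    and "jacobi_transformation N k m \<Gamma> \<psi>"
    and "mero_simple_poles \<psi>"
    and "jacobi_poles \<psi> \<subseteq> \<rat> \<times> \<rat>"
  shows "\<forall>\<tau> z. Im \<tau> > 0 \<and> z \<notin> pole_points \<psi> \<tau> \<longrightarrow>
           \<psi> \<tau> z = psiF N m \<psi> \<tau> z + psiP N m \<psi> \<tau> z"
proof (intro allI impI; elim conjE)
  fix \<tau> z0 :: complex
  assume \<tau>: "Im \<tau> > 0" and z0: "z0 \<notin> pole_points \<psi> \<tau>"
  define T where "T = of_nat N * \<tau>"
  have mT: "m \<ge> 1" "Im T > 0" using assms(1,2) \<tau> by (auto simp: T_def)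
  define S where "S = jacobi_poles \<psi>"
  define P where "P = pole_points \<psi> \<tau>"
  define Q where "Q = S // lattice_rel N S"
  define x where "x = (\<lambda>X. zs (SOME s. s \<in> X) \<tau>)"
  \<comment> \<open>The index of \<open>Rc\<close> in \<open>Atilde\<close>; equivalently Im (x X) =
    -c Im T / (2m), the position that \<open>appell_pair_integral\<close> expects.\<close>
  define c where "c = (\<lambda>X. - 2 * real m * fst (SOME s::real \<times> real. s \<in> X) / real N)"
  \<comment> \<open>Half of the 2 pi \<i> in \<open>Dcoef\<close>, because
    \<open>appell_pair\<close> is a sum and not a mean; the exponential factors of
    \<open>Dcoef\<close> and \<open>Atilde\<close> cancel.\<close>
  define R where "R = (\<lambda>X. of_real pi * \<i> * residue (\<psi> \<tau>) (x X))"
  define B where "B = (\<lambda>X. appell_pair m T (c X) (x X))"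
  define fac where "fac = (\<lambda>l::int. \<lambda>z. ee (- (of_nat m * of_int l ^ 2 * T + 2 * of_nat m * of_int l * z)))"
  define \<phi>0 where "\<phi>0 = (\<lambda>z. \<psi> \<tau> z - (\<Sum>X\<in>Q. R X * B X z))"
  define \<phi> where "\<phi> = (\<lambda>z. Lim (at z) \<phi>0)"
  have finQ: "finite Q"
    unfolding Q_def S_def by (rule finite_pole_orbits[OF assms(4,1,5)])
  note equiv = equiv_lattice_rel[of S N]
  have rep: "(SOME s. s \<in> X) \<in> X" if "X \<in> Q" for X
  proof -
    have "X \<noteq> {}" using that equiv by (auto simp: Q_def in_quotient_imp_non_empty)
    then show ?thesis by (simp add: some_in_eq)
  qed
  have rep_S: "(SOME s. s \<in> X) \<in> S" if "X \<in> Q" for X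
    using rep[OF that] that equiv in_quotient_imp_subset unfolding Q_def by blast
  \<comment> \<open>Representatives of different orbits are incongruent modulo the lattice, so near
    \<open>x X\<close> the only singular summand is the one for \<open>X\<close>.\<close>
  have rel_eq: "X = Y" if "X \<in> Q" "Y \<in> Q" "x X = x Y + of_int l * T + of_int \<mu>" for X Y and l \<mu> :: int
  proof -
    have "zs (SOME s. s \<in> X) \<tau> = zs (fst (SOME s. s \<in> Y) + real N * of_int l, snd (SOME s. s \<in> Y) + of_int \<mu>) \<tau>"
      using that(3) by (simp add: x_def zs_def T_def algebra_simps)
    then have "(SOME s. s \<in> X) = (fst (SOME s. s \<in> Y) + real N * of_int l, snd (SOME s. s \<in> Y) + of_int \<mu>)"
      using \<tau> zs_inj by blast
    then have "(SOME s. s \<in> Y, SOME s. s \<in> X) \<in> lattice_rel N S"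
      using rep_S that unfolding lattice_rel_def by blast
    then show ?thesis
      using quotient_eq_iff[OF equiv, of Y X "SOME s. s \<in> Y" "SOME s. s \<in> X"] rep that
      unfolding Q_def by blast
  qed
  have P_shift: "z + of_int l * T + of_int \<mu> \<in> P" if z: "z \<in> P" for z and l \<mu> :: int
  proof -
    obtain s where s: "s \<in> S" "z = zs s \<tau>" using z by (auto simp: P_def pole_points_def S_def)
    have "z + of_int l * T + of_int \<mu> = zs (fst s + real N * of_int l, snd s + of_int \<mu>) \<tau>"
      by (simp add: s zs_def T_def algebra_simps)
    then show ?thesis
      using jacobi_poles_shift[OF assms(4,1,5), of s l \<mu>] s by (auto simp: P_def pole_points_def S_def)
  qed
  have P_shift_iff: "z + of_int l * T + of_int \<mu> \<in> P \<longleftrightarrow> z \<in> P" for z and l \<mu> :: int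
    using P_shift[of z l \<mu>] P_shift[of "z + of_int l * T + of_int \<mu>" "- l" "- \<mu>"] by auto
  have x_P: "x X \<in> P" if "X \<in> Q" for X
    using rep_S[OF that] by (auto simp: x_def P_def pole_points_def S_def)
  have P_cases: "\<exists>X\<in>Q. \<exists>l \<mu>::int. z = x X + of_int l * T + of_int \<mu>" if z: "z \<in> P" for z
  proof -
    obtain s where s: "s \<in> S" "z = zs s \<tau>" using z by (auto simp: P_def pole_points_def S_def)
    define X where "X = lattice_rel N S `` {s}"
    have X: "X \<in> Q" unfolding Q_def X_def using s(1) by (rule quotientI)
    have "(s, SOME s. s \<in> X) \<in> lattice_rel N S" using rep[OF X] by (simp add: X_def)
    then have "(SOME s. s \<in> X, s) \<in> lattice_rel N S" using equiv by (meson equivE symD)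
    then obtain l \<mu> :: int where "s = (fst (SOME s. s \<in> X) + real N * of_int l, snd (SOME s. s \<in> X) + of_int \<mu>)"
      unfolding lattice_rel_def by blast
    then have "z = x X + of_int l * T + of_int \<mu>"
      unfolding s(2) x_def by (simp add: zs_def T_def algebra_simps)
    with X show ?thesis by blast
  qed
  have lattice_form: "\<exists>k::int. z = x X + of_int (- n) * T + of_int k" if e: "ee (of_int n * T + (z - x X)) = 1" for X z n
  proof -
    obtain k :: int where "of_int n * T + (z - x X) = of_int k" using e by (auto simp: ee_eq_1_iff)
    then have "z = x X + of_int (- n) * T + of_int k" by (simp add: algebra_simps)
    then show ?thesis by blast
  qed
  have generic: "ee (of_int n * T + (z - x X)) \<noteq> 1" if "z \<notin> P" "X \<in> Q" for X z n
    using lattice_form[of n z X] P_shift x_P that by blast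
  have P_discrete: "\<not> z islimpt P" for z
    using assms(5) \<tau> unfolding mero_simple_poles_def P_def by blast
  have openP: "open (- P)"
    using P_discrete closed_limpt[of P] by (simp add: open_Compl)
  have \<psi>_holo: "\<psi> \<tau> holomorphic_on - P"
    using assms(5) \<tau> unfolding mero_simple_poles_def P_def by blast
  have B_holo: "B X holomorphic_on - P" if "X \<in> Q" for X
    unfolding B_def using generic[OF _ that] by (intro appell_pair_holomorphic mT openP) auto
  have \<phi>0_holo: "\<phi>0 holomorphic_on - P"
    unfolding \<phi>0_def by (intro holomorphic_intros \<psi>_holo B_holo)
  have \<phi>0_shift: "\<phi>0 (z + of_int l * T + of_int \<mu>) = fac l z * \<phi>0 z" if "z \<notin> P" for z l \<mu>
    using elliptic_transformation[OF assms(4,1) \<tau>, of z l \<mu>] that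
    by (simp add: \<phi>0_def B_def appell_pair_shift fac_def P_def T_def right_diff_distrib
          sum_distrib_left mult.left_commute)
  have psiP_eq: "psiP N m \<psi> \<tau> z = (\<Sum>X\<in>Q. R X * B X z)" if "z \<notin> P" for z
    unfolding psiP_def Q_def[symmetric, unfolded S_def]
  proof (intro sum.cong)
    fix X assume X: "X \<in> Q"
    let ?s = "SOME s. s \<in> X"
    define E where "E = ee (of_nat m / of_nat N * of_real (fst ?s) * x X)"
    define E' where "E' = ee (- (of_nat m / of_nat N) * of_real (fst ?s) * x X)"
    have A: "Atilde N m ?s \<tau> z = E' * (B X z / 2)"
      using Atilde_eq[of m N \<tau> z ?s] generic[OF that X] mT
      by (simp add: E'_def x_def B_def c_def T_def)
    have D: "Dcoef N m \<psi> ?s \<tau> = 2 * of_real pi * \<i> * E * residue (\<psi> \<tau>) (x X)"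
      by (simp only: Dcoef_def x_def E_def)
    have "Dcoef N m \<psi> ?s \<tau> * Atilde N m ?s \<tau> z = (E * E') * (R X * B X z)"
      unfolding A D R_def by simp
    also have "E * E' = 1" by (simp add: E_def E'_def flip: ee_add)
    finally show "(let s = ?s in Dcoef N m \<psi> s \<tau> * Atilde N m s \<tau> z) = R X * B X z"
      by (simp add: Let_def)
  qed (simp add: Q_def S_def)
  have pole_rep: "((\<lambda>z. (z - x X) * \<phi>0 z) \<longlongrightarrow> 0) (at (x X))" if X: "X \<in> Q" for X
  proof -
    obtain r where r: "r > 0" "\<And>y. y \<in> P \<Longrightarrow> y \<noteq> x X \<Longrightarrow> dist y (x X) \<ge> r"
      using P_discrete[of "x X"] unfolding islimpt_approachable by (meson not_less)
    have ballP: "ball (x X) r - {x X} \<subseteq> - P" using r(2) by (force simp: dist_commute)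
    obtain a where "((\<lambda>w. (w - x X) * \<psi> \<tau> w) \<longlongrightarrow> a) (at (x X))"
      using assms(5) \<tau> x_P[OF X] unfolding mero_simple_poles_def P_def by blast
    moreover from this have "residue (\<psi> \<tau>) (x X) = a"
      using r(1) ballP by (intro residue_simple'[of "ball (x X) r"] holomorphic_on_subset[OF \<psi>_holo])
        (auto simp: mult.commute)
    ultimately have \<psi>: "((\<lambda>w. (w - x X) * \<psi> \<tau> w) \<longlongrightarrow> residue (\<psi> \<tau>) (x X)) (at (x X))" by simp
    have other: "((\<lambda>z. (z - x X) * (R Y * B Y z)) \<longlongrightarrow> (if Y = X then residue (\<psi> \<tau>) (x X) else 0)) (at (x X))"
      if Y: "Y \<in> Q" for Y
    proof (cases "Y = X")
      case True
      have "((\<lambda>z. R X * ((z - x X) * B X z)) \<longlongrightarrow> R X * (1 / (of_real pi * \<i>))) (at (x X))"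
        unfolding B_def by (intro tendsto_intros appell_pair_pole mT)
      then show ?thesis using True by (simp add: R_def mult_ac)
    next
      case False
      have "ee (of_int n * T + (z - x Y)) \<noteq> 1" if z: "z \<in> ball (x X) r" for z n
      proof (cases "z = x X")
        case True
        then show ?thesis using lattice_form[of n z Y] rel_eq[OF X Y] False by blast
      next
        case False
        then show ?thesis using generic[OF _ Y] ballP z by blast
      qed
      then have "B Y holomorphic_on ball (x X) r"
        unfolding B_def by (intro appell_pair_holomorphic mT) auto
      then have "(B Y \<longlongrightarrow> B Y (x X)) (at (x X))"
        using r(1) by (metis centre_in_ball continuous_on_interior holomorphic_on_imp_continuous_on
            interior_ball isCont_def)
      then have "((\<lambda>z. (z - x X) * (R Y * B Y z)) \<longlongrightarrow> (x X - x X) * (R Y * B Y (x X))) (at (x X))"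
        by (intro tendsto_intros)
      then show ?thesis using False by simp
    qed
    have "((\<lambda>z. (z - x X) * \<psi> \<tau> z - (\<Sum>Y\<in>Q. (z - x X) * (R Y * B Y z))) \<longlongrightarrow>
        residue (\<psi> \<tau>) (x X) - (\<Sum>Y\<in>Q. if Y = X then residue (\<psi> \<tau>) (x X) else 0)) (at (x X))"
      by (intro tendsto_diff \<psi> tendsto_sum other)
    then show ?thesis
      using finQ X by (simp add: \<phi>0_def right_diff_distrib sum_distrib_left)
  qed
  \<comment> \<open>Any other pole is a lattice translate of a representative, and the
    transformation law of \<open>\<phi>0\<close> carries the vanishing limit there; no residue at a
    translate has to be computed.\<close>
  have pole: "((\<lambda>z. (z - p) * \<phi>0 z) \<longlongrightarrow> 0) (at p)" if pP: "p \<in> P" for p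
  proof -
    obtain X l \<mu> where X: "X \<in> Q" and p: "p = x X + (of_int l * T + of_int \<mu>)"
      using P_cases[OF pP] by (auto simp: add.assoc)
    have "(fac l \<longlongrightarrow> fac l (x X)) (at (x X))"
      unfolding fac_def by (intro tendsto_intros)
    from tendsto_mult[OF this pole_rep[OF X]]
    have "((\<lambda>y. fac l y * ((y - x X) * \<phi>0 y)) \<longlongrightarrow> 0) (at (x X))" by simp
    then have "((\<lambda>y. (y + (of_int l * T + of_int \<mu>) - p) * \<phi>0 (y + (of_int l * T + of_int \<mu>))) \<longlongrightarrow> 0) (at (x X))"
    proof (rule Lim_transform_eventually)
      have "eventually (\<lambda>y. y \<notin> P) (at (x X))"
        using P_discrete by (simp add: islimpt_iff_eventually)
      then show "eventually (\<lambda>y. fac l y * ((y - x X) * \<phi>0 y)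
          = (y + (of_int l * T + of_int \<mu>) - p) * \<phi>0 (y + (of_int l * T + of_int \<mu>))) (at (x X))"
        by eventually_elim (simp add: \<phi>0_shift p flip: add.assoc)
    qed
    then show ?thesis
      using filterlim_shift_iff[of "\<lambda>z. (z - p) * \<phi>0 z" "of_int l * T + of_int \<mu>" "nhds 0" p]
      by (simp add: o_def p add.commute)
  qed
  have P_discrete': "\<And>z. z \<in> UNIV \<Longrightarrow> \<not> z islimpt P" using P_discrete by simp
  have \<phi>0_holo': "\<phi>0 holomorphic_on (UNIV - P)" using \<phi>0_holo by (simp add: Compl_eq_Diff_UNIV)
  have pole': "\<And>p. p \<in> P \<inter> UNIV \<Longrightarrow> ((\<lambda>z. (z - p) * \<phi>0 z) \<longlongrightarrow> 0) (at p)" using pole by simp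
  note ext = removable_extension[OF open_UNIV P_discrete' \<phi>0_holo' pole', folded \<phi>_def]
  have \<phi>_holo: "\<phi> holomorphic_on UNIV" using ext(1) by (simp add: \<phi>_def)
  have \<phi>_eq: "\<phi> z = \<phi>0 z" if "z \<notin> P" for z using ext(3)[of z] that by (simp add: \<phi>_def)
  have \<phi>_lim: "(\<phi>0 \<longlongrightarrow> \<phi> z) (at z)" for z using ext(2)[of z] by (simp add: \<phi>_def)
  have \<phi>_shift: "\<phi> (z + (of_int l * T + of_int \<mu>)) = fac l z * \<phi> z" for z l \<mu>
  proof -
    have "(fac l \<longlongrightarrow> fac l z) (at z)"
      unfolding fac_def by (intro tendsto_intros)
    from tendsto_mult[OF this \<phi>_lim]
    have "((\<lambda>y. \<phi>0 (y + (of_int l * T + of_int \<mu>))) \<longlongrightarrow> fac l z * \<phi> z) (at z)"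
    proof (rule Lim_transform_eventually)
      have "eventually (\<lambda>y. y \<notin> P) (at z)"
        using P_discrete by (simp add: islimpt_iff_eventually)
      then show "eventually (\<lambda>y. fac l y * \<phi>0 y = \<phi>0 (y + (of_int l * T + of_int \<mu>))) (at z)"
        by eventually_elim (simp add: \<phi>0_shift flip: add.assoc)
    qed
    then show ?thesis
      unfolding \<phi>_def Lim_at_shift by (intro tendsto_Lim) auto
  qed
  have \<phi>_1: "\<phi> (z + 1) = \<phi> z" for z using \<phi>_shift[of z 0 1] by (simp add: fac_def)
  have \<phi>_T: "\<phi> (z + T) = ee (- (of_nat m * T + 2 * of_nat m * z)) * \<phi> z" for z
    using \<phi>_shift[of z 1 0] by (simp add: fac_def)
  define w where "w = (\<lambda>l::int. - (of_int l * of_nat N / (2 * of_nat m)) * \<tau>)"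
  have \<phi>_int: "period_integral a (\<lambda>u. \<phi> u * ee (- of_int l * u)) = period_integral b (\<lambda>u. \<phi> u * ee (- of_int l * u))"
    for a b and l :: int
  proof (rule period_integral_independent[of UNIV])
    fix u
    have "ee (- of_int l * (u + 1)) = ee (- of_int l * u)"
      using ee_plus_of_int[of "- of_int l * u" "- l"] by (simp add: algebra_simps)
    then show "u + 1 \<in> UNIV \<and> \<phi> (u + 1) * ee (- of_int l * (u + 1)) = \<phi> u * ee (- of_int l * u)"
      using \<phi>_1 by simp
  qed (use \<phi>_holo in \<open>auto intro!: holomorphic_intros\<close>)
  have h: "hcoef N m \<psi> l \<tau> = ee (- (of_int l ^ 2 * of_nat N / (4 * of_nat m)) * \<tau>)
      * period_integral (w l) (\<lambda>u. \<phi> u * ee (- of_int l * u))" for l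
  proof -
    define good where "good = (\<lambda>X e k. 0 < e \<and> (\<forall>\<epsilon>. 0 < \<bar>\<epsilon>\<bar> \<longrightarrow> \<bar>\<epsilon>\<bar> < e \<longrightarrow>
        (\<forall>n. Im (of_int n * T + (w l + \<i> * of_real \<epsilon> - x X)) \<noteq> 0) \<and>
        period_integral (w l + \<i> * of_real \<epsilon>) (\<lambda>u. B X u * ee (- of_int l * u)) = of_real (sgn \<epsilon>) * k))"
    have "\<exists>e k. good X e k" for X
    proof -
      have xI: "Im (x X) = - c X * Im T / (2 * real m)"
        using assms(1,2) by (simp add: x_def c_def zs_def T_def)
      have "w l = of_real (- (of_int l / (2 * real m))) * T" by (simp add: w_def T_def)
      then have wI: "Im (w l) = - of_int l * Im T / (2 * real m)"
        by (simp only: times_complex.sel Re_complex_of_real Im_complex_of_real) simp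
      obtain e k where "e > 0"
        "\<And>\<epsilon> n. 0 < \<bar>\<epsilon>\<bar> \<Longrightarrow> \<bar>\<epsilon>\<bar> < e \<Longrightarrow> Im (of_int n * T + (w l + \<i> * of_real \<epsilon> - x X)) \<noteq> 0"
        "\<And>\<epsilon>. 0 < \<bar>\<epsilon>\<bar> \<Longrightarrow> \<bar>\<epsilon>\<bar> < e \<Longrightarrow>
          period_integral (w l + \<i> * of_real \<epsilon>) (\<lambda>u. appell_pair m T (c X) (x X) u * ee (- of_int l * u))
          = of_real (sgn \<epsilon>) * k"
        by (rule appell_pair_integral[OF mT xI wI]) blast
      then show ?thesis
        unfolding good_def B_def by blast
    qed
    then obtain e \<kappa> where "\<And>X. good X (e X) (\<kappa> X)" by metis
    then have e: "\<And>X. 0 < e X"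
      "\<And>X \<epsilon> n. 0 < \<bar>\<epsilon>\<bar> \<Longrightarrow> \<bar>\<epsilon>\<bar> < e X \<Longrightarrow> Im (of_int n * T + (w l + \<i> * of_real \<epsilon> - x X)) \<noteq> 0"
      "\<And>X \<epsilon>. 0 < \<bar>\<epsilon>\<bar> \<Longrightarrow> \<bar>\<epsilon>\<bar> < e X \<Longrightarrow>
        period_integral (w l + \<i> * of_real \<epsilon>) (\<lambda>u. B X u * ee (- of_int l * u)) = of_real (sgn \<epsilon>) * \<kappa> X"
      unfolding good_def by blast+
    \<comment> \<open>One bound for the finitely many orbits; the entry 1 covers the case without
      poles.\<close>
    define \<epsilon>0 where "\<epsilon>0 = Min (insert 1 (e ` Q))"
    have \<epsilon>0: "\<epsilon>0 > 0" "\<And>X. X \<in> Q \<Longrightarrow> \<epsilon>0 \<le> e X"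
      unfolding \<epsilon>0_def using finQ e(1) by auto
    show ?thesis
    proof (rule hcoef_eq[where K = "\<Sum>X\<in>Q. R X * \<kappa> X"])
      show "\<epsilon>0 > 0" by fact
      fix \<epsilon> :: real assume \<epsilon>: "0 < \<bar>\<epsilon>\<bar>" "\<bar>\<epsilon>\<bar> < \<epsilon>0"
      define a where "a = w l + \<i> * of_real \<epsilon>"
      have line: "{u. Im u = Im a} \<subseteq> - P"
      proof safe
        fix u assume u: "Im u = Im a" "u \<in> P"
        obtain X and j \<mu> :: int where X: "X \<in> Q" "u = x X + of_int j * T + of_int \<mu>"
          using P_cases[OF u(2)] by blast
        then have "of_int (- j) * T + (u - x X) = of_int \<mu>" by simp
        then have "Im (of_int (- j) * T + (u - x X)) = 0" by (simp only: complex_Im_of_int)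
        then have "Im (of_int (- j) * T + (a - x X)) = 0" using u(1) by simp
        moreover have "\<bar>\<epsilon>\<bar> < e X" using \<epsilon>(2) \<epsilon>0(2)[OF X(1)] by linarith
        ultimately show False using e(2)[OF \<epsilon>(1), of X "- j"] unfolding a_def by blast
      qed
      have cont: "continuous_on {u. Im u = Im a} (\<lambda>u. R X * (B X u * ee (- of_int l * u)))" if "X \<in> Q" for X
        by (intro continuous_intros continuous_on_subset[OF holomorphic_on_imp_continuous_on[OF B_holo[OF that]] line])
      have cont_\<phi>: "continuous_on {u. Im u = Im a} (\<lambda>u. \<phi> u * ee (- of_int l * u))"
        by (intro continuous_intros continuous_on_subset[OF holomorphic_on_imp_continuous_on[OF \<phi>_holo]]) auto
      have "period_integral a (\<lambda>u. \<psi> \<tau> u * ee (- of_int l * u))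
          = period_integral a (\<lambda>u. \<phi> u * ee (- of_int l * u) + (\<Sum>X\<in>Q. R X * (B X u * ee (- of_int l * u))))"
      proof (rule period_integral_cong)
        fix u assume "Im u = Im a"
        then have "u \<notin> P" using line by blast
        then show "\<psi> \<tau> u * ee (- of_int l * u)
            = \<phi> u * ee (- of_int l * u) + (\<Sum>X\<in>Q. R X * (B X u * ee (- of_int l * u)))"
          by (simp add: \<phi>_eq \<phi>0_def left_diff_distrib sum_distrib_right mult.assoc)
      qed
      also have "\<dots> = period_integral a (\<lambda>u. \<phi> u * ee (- of_int l * u))
          + (\<Sum>X\<in>Q. period_integral a (\<lambda>u. R X * (B X u * ee (- of_int l * u))))"
        using cont cont_\<phi> finQ
        by (simp only: period_integral_add continuous_on_sum period_integral_sum)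
      also have "(\<Sum>X\<in>Q. period_integral a (\<lambda>u. R X * (B X u * ee (- of_int l * u)))) = of_real (sgn \<epsilon>) * (\<Sum>X\<in>Q. R X * \<kappa> X)"
        unfolding sum_distrib_left
      proof (intro sum.cong refl)
        fix X assume "X \<in> Q"
        then have "\<bar>\<epsilon>\<bar> < e X" using \<epsilon>(2) \<epsilon>0(2)[of X] by linarith
        from e(3)[OF \<epsilon>(1) this]
        show "period_integral a (\<lambda>u. R X * (B X u * ee (- of_int l * u))) = of_real (sgn \<epsilon>) * (R X * \<kappa> X)"
          by (simp only: period_integral_cmult a_def mult.left_commute)
      qed
      finally have "period_integral (w l + \<i> * of_real \<epsilon>) (\<lambda>u. \<psi> \<tau> u * ee (- of_int l * u))
          = period_integral (w l) (\<lambda>u. \<phi> u * ee (- of_int l * u)) + of_real (sgn \<epsilon>) * (\<Sum>X\<in>Q. R X * \<kappa> X)"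
        unfolding a_def \<phi>_int[of "w l + \<i> * of_real \<epsilon>" l "w l"] .
      then show "period_integral (- (of_int l * of_nat N / (2 * of_nat m)) * \<tau> + \<i> * of_real \<epsilon>) (\<lambda>u. \<psi> \<tau> u * ee (- of_int l * u))
          = period_integral (w l) (\<lambda>u. \<phi> u * ee (- of_int l * u)) + of_real (sgn \<epsilon>) * (\<Sum>X\<in>Q. R X * \<kappa> X)"
        by (simp only: w_def)
    qed
  qed
  have "psiF N m \<psi> \<tau> z0 = (\<Sum>j<2*m. hcoef N m \<psi> (int j) \<tau> * theta m (int j) T z0)"
  proof -
    have "bij_betw int {..<2*m} {0..<2 * int m}"
      by (rule bij_betwI[where g = nat]) auto
    from sum.reindex_bij_betw[OF this, of "\<lambda>l. hcoef N m \<psi> l \<tau> * theta m l T z0"]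
    show ?thesis by (simp add: psiF_def T_def)
  qed
  also have "\<dots> = (\<Sum>j<2*m. theta_coeff m T j z0 * period_integral (w (int j)) (\<lambda>u. \<phi> u * ee (- of_nat j * u)))"
  proof (intro sum.cong refl)
    fix j :: nat
    \<comment> \<open>The prefactor of h_j is inverse to the factor by which \<open>theta\<close>
      differs from \<open>theta_coeff\<close>.\<close>
    have "ee (- (of_int (int j) ^ 2 * of_nat N / (4 * of_nat m)) * \<tau>) * ee (of_nat j ^ 2 / (4 * of_nat m) * T) = 1"
      by (simp add: T_def flip: ee_add)
    then show "hcoef N m \<psi> (int j) \<tau> * theta m (int j) T z0
        = theta_coeff m T j z0 * period_integral (w (int j)) (\<lambda>u. \<phi> u * ee (- of_nat j * u))"
      unfolding h theta_eq[OF mT(1)] by (simp add: mult_ac)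
  qed
  also have "\<dots> = \<phi> z0"
    by (rule quasi_periodic_expansion[OF mT \<phi>_holo \<phi>_1 \<phi>_T, symmetric])
  finally have "psiF N m \<psi> \<tau> z0 = \<phi>0 z0" using \<phi>_eq z0 by (simp add: P_def)
  then show "\<psi> \<tau> z0 = psiF N m \<psi> \<tau> z0 + psiP N m \<psi> \<tau> z0"
    using psiP_eq[of z0] z0 by (simp add: \<phi>0_def P_def)
qed

end
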